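(* Let $\mathcal{G}$ be a non-empty set of finite groups, $R$ a commutative unital ring in which $\mathbb{Q}$ embeds (every positive integer is invertible in $R$), and $A$ a multiplicatively written abelian group. Let $\ell : \mathbb{N}\setminus\{0\}\to R^\times$ be a homomorphism of multiplicative monoids, and suppose $\ell(n)=n$ for all positive integers $n$. Then there is an object-identical isomorphism of $R$-linear categories $\overline{R_\ell\mathcal{S}^A}\cong R\mathcal{B}^A$ given by $$|G|\,\overline{s}^{F,G}_{U,\mu}\ \leftrightarrow\ |U|\,[(F\times G)/(U,\mu)]$$ for $F,G\in\mathcal{G}$ and $[U,\mu]\in\mathcal{S}^A[F,G]$, where $\overline{R_\ell\mathcal{S}^A}$ and the $R$-linear $A$-fibred biset category $R\mathcal{B}^A$ are as defined in the context.
   Context: Conventions. $F,G,H$ denote arbitrary elements of $\mathcal{G}$; elements of $F\times G$ are written $f\times g$. For a category with object set $\mathcal{G}$, $\mathcal{L}(F,G)$ denotes the set of morphisms to $F$ from $G$, so composition is a map $\mathcal{L}(F,G)\times\mathcal{L}(G,H)\to\mathcal{L}(F,H)$. A category is $R$-linear if its morphism sets are $R$-modules and composition is $R$-bilinear; functors between $R$-linear categories are $R$-linear on morphisms. A functor between categories on the same object set is object-identical if it is the identity on objects. For $g\in G$, ${}^g y=gyg^{-1}$. Subgroups. For $U\le F\times G$ and $V\le G\times H$: $U*V=\{f\times h : \exists g\in G,\ f\times g\in U,\ g\times h\in V\}\le F\times H$; $p_2(U)\le G$ and $p_1(V)\le G$ are the images of the projections of $U$ and $V$ to $G$; $\Gamma_\cap(U,V)=\{g\in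 G : 1\times g\in U,\ g\times 1\in V\}$. $A$-subcharacters. An $A$-subcharacter of a finite group $E$ is a pair $(T,\tau)$ with $T\le E$ and $\tau:T\to A$ a homomorphism. $E$ acts on the set of these by ${}^g(T,\tau)=({}^gT,{}^g\tau)$, ${}^g\tau({}^gt)=\tau(t)$; $[T,\tau]$ denotes the $E$-orbit. $\mathcal{S}^A(F,G)$ is the set of $A$-subcharacters of $F\times G$ and $\mathcal{S}^A[F,G]$ its set of $F\times G$-orbits. For $(U,\mu)\in\mathcal{S}^A(F,G)$ and $(V,\nu)\in\mathcal{S}^A(G,H)$, write $(U,\mu)\sim(V,\nu)$ if $\mu(1\times g)\nu(g\times 1)=1$ for all $g\in\Gamma_\cap(U,V)$; in that case $\mu*\nu:U*V\to A$ is the homomorphism $(\mu*\nu)(f\times h)=\mu(f\times g)\nu(g\times h)$ for any $g$ with $f\times g\in U$, $g\times h\in V$. For $g\in G$, ${}^g(V,\nu)=({}^gV,{}^g\nu)$ means ${}^{g\times 1}(V,\nu)$. The category $R_\ell\mathcal{S}^A$. This is the $R$-linear category on $\mathcal{G}$ where $R_\ell\mathcal{S}^A(F,G)$ is the free $R$-module on symbols $s^{F,G}_{U,\mu}$, $(U,\mu)\in\mathcal{S}^A(F,G)$, with $R$-bilinear composition $s^{F,G}_{U,\mu}s^{G,H}_{V,\nu}=\ell(|\Gamma_\cap(U,V)|)\,s^{F,H}_{U*V,\mu*\nu}$ if $(U,\mu)\sim(V,\nu)$ and $0$ otherwise. The identity on $G$ is $s^{G,G}_{\Delta(G),1}$,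 where $\Delta(G)=\{y\times y:y\in G\}$ and $1$ is the trivial homomorphism. There is an algebra map $\sigma_G: RG\to R_\ell\mathcal{S}^A(G,G)$ with $\sigma_G(g)=s^{G,G}_{\Delta(G,g,G),1}$, where $\Delta(G,g,G)=\{{}^gy\times y:y\in G\}$. $F\times G$ acts on $R_\ell\mathcal{S}^A(F,G)$ by ${}^{f\times g}\phi=\sigma_F(f)\,\phi\,\sigma_G(g)^{-1}$. The invariant category $\overline{R_\ell\mathcal{S}^A}$. It is the $R$-linear category on $\mathcal{G}$ with $\overline{R_\ell\mathcal{S}^A}(F,G)=R_\ell\mathcal{S}^A(F,G)^{F\times G}$ (the fixed submodule), with composition restricted from that of $R_\ell\mathcal{S}^A$, and with identities $\sigma_G(e_G)$, where $e_G=\frac{1}{|G|}\sum_{g\in G}g$. Put $\overline{s}^{F,G}_{U,\mu}=\sigma_F(e_F)\,s^{F,G}_{U,\mu}\,\sigma_G(e_G)$; this depends only on $F$, $G$ and $[U,\mu]$, and these elements, for $[U,\mu]\in\mathcal{S}^A[F,G]$, form an $R$-basis of $\overline{R_\ell\mathcal{S}^A}(F,G)$. The $R$-linear $A$-fibred biset category $R\mathcal{B}^A$ on $\mathcal{G}$. $R\mathcal{B}^A(F,G)$ is the free $R$-module on formal symbols $[(F\times G)/(U,\mu)]$, one for each orbit $[U,\mu]\in\mathcal{S}^A[F,G]$. Composition is the $R$-bilinear map with $$[(F\times G)/(U,\mu)]\cdot[(G\times H)/(V,\nu)]=\sum_g[(F\times H)/(U*{}^gV,\ \mu*{}^g\nu)],$$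 where $g$ runs over representatives of the double cosets $p_2(U)\,g\,p_1(V)\subseteq G$ such that $(U,\mu)\sim{}^g(V,\nu)$ (independent of the choices of representatives). The identity on $G$ is $[(G\times G)/(\Delta(G),1)]$. *)

theory Defs
  imports Complex_Main "HOL-Algebra.Group_Action" "HOL-Library.Poly_Mapping"
begin

section \<open>Linear categories\<close>

text \<open>
  \<open>Mor C F G\<close> is the set of morphisms to \<open>F\<close> from \<open>G\<close>, and \<open>Comp C F G H\<close> is the composition
  \<open>Mor C F G \<times> Mor C G H \<rightarrow> Mor C F H\<close>.  All morphism sets are submodules of one ambient module;
  since they are indexed by pairs of objects, they need not be disjoint.
\<close>

record ('o, 'm, 'r) lincat =
  Obj :: "'o set"
  Mor :: "'o \<Rightarrow> 'o \<Rightarrow> 'm set"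
  Scl :: "'r \<Rightarrow> 'm \<Rightarrow> 'm"
  Comp :: "'o \<Rightarrow> 'o \<Rightarrow> 'o \<Rightarrow> 'm \<Rightarrow> 'm \<Rightarrow> 'm"
  Ident :: "'o \<Rightarrow> 'm"

locale linear_category = Modules.module "Scl C"
  for C :: "('o, 'm::ab_group_add, 'r::comm_ring_1) lincat" +
  assumes Mor_submodule: "\<lbrakk>F \<in> Obj C; G \<in> Obj C\<rbrakk> \<Longrightarrow> subspace (Mor C F G)"
    and Comp_closed: "\<lbrakk>F \<in> Obj C; G \<in> Obj C; H \<in> Obj C; x \<in> Mor C F G; y \<in> Mor C G H\<rbrakk>
      \<Longrightarrow> Comp C F G H x y \<in> Mor C F H"
    and Comp_add_left: "\<lbrakk>F \<in> Obj C; G \<in> Obj C; H \<in> Obj C;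
        x \<in> Mor C F G; x' \<in> Mor C F G; y \<in> Mor C G H\<rbrakk>
      \<Longrightarrow> Comp C F G H (x + x') y = Comp C F G H x y + Comp C F G H x' y"
    and Comp_add_right: "\<lbrakk>F \<in> Obj C; G \<in> Obj C; H \<in> Obj C;
        x \<in> Mor C F G; y \<in> Mor C G H; y' \<in> Mor C G H\<rbrakk>
      \<Longrightarrow> Comp C F G H x (y + y') = Comp C F G H x y + Comp C F G H x y'"
    and Comp_scale_left: "\<lbrakk>F \<in> Obj C; G \<in> Obj C; H \<in> Obj C; x \<in> Mor C F G; y \<in> Mor C G H\<rbrakk>
      \<Longrightarrow> Comp C F G H (Scl C r x) y = Scl C r (Comp C F G H x y)"
    and Comp_scale_right: "\<lbrakk>F \<in> Obj C; G \<in> Obj C; H \<in> Obj C; x \<in> Mor C F G; y \<in> Mor C G H\<rbrakk>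
      \<Longrightarrow> Comp C F G H x (Scl C r y) = Scl C r (Comp C F G H x y)"
    and Comp_assoc: "\<lbrakk>F \<in> Obj C; G \<in> Obj C; H \<in> Obj C; I \<in> Obj C;
        x \<in> Mor C F G; y \<in> Mor C G H; z \<in> Mor C H I\<rbrakk>
      \<Longrightarrow> Comp C F H I (Comp C F G H x y) z = Comp C F G I x (Comp C G H I y z)"
    and Ident_closed: "G \<in> Obj C \<Longrightarrow> Ident C G \<in> Mor C G G"
    and Comp_Ident_left: "\<lbrakk>F \<in> Obj C; G \<in> Obj C; x \<in> Mor C F G\<rbrakk>
      \<Longrightarrow> Comp C F F G (Ident C F) x = x"
    and Comp_Ident_right: "\<lbrakk>F \<in> Obj C; G \<in> Obj C; x \<in> Mor C F G\<rbrakk>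
      \<Longrightarrow> Comp C F G G x (Ident C G) = x"

locale object_identical_functor = C: linear_category C + D: linear_category D
  for C :: "('o, 'm::ab_group_add, 'r::comm_ring_1) lincat"
    and D :: "('o, 'n::ab_group_add, 'r) lincat" +
  fixes \<Phi> :: "'o \<Rightarrow> 'o \<Rightarrow> 'm \<Rightarrow> 'n"
  assumes Obj_eq: "Obj C = Obj D"
    and map_closed: "\<lbrakk>F \<in> Obj C; G \<in> Obj C; x \<in> Mor C F G\<rbrakk> \<Longrightarrow> \<Phi> F G x \<in> Mor D F G"
    and map_add: "\<lbrakk>F \<in> Obj C; G \<in> Obj C; x \<in> Mor C F G; y \<in> Mor C F G\<rbrakk>
      \<Longrightarrow> \<Phi> F G (x + y) = \<Phi> F G x + \<Phi> F G y"
    and map_scale: "\<lbrakk>F \<in> Obj C; G \<in> Obj C; x \<in> Mor C F G\<rbrakk>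
      \<Longrightarrow> \<Phi> F G (Scl C r x) = Scl D r (\<Phi> F G x)"
    and map_Comp: "\<lbrakk>F \<in> Obj C; G \<in> Obj C; H \<in> Obj C; x \<in> Mor C F G; y \<in> Mor C G H\<rbrakk>
      \<Longrightarrow> \<Phi> F H (Comp C F G H x y) = Comp D F G H (\<Phi> F G x) (\<Phi> G H y)"
    and map_Ident: "G \<in> Obj C \<Longrightarrow> \<Phi> G G (Ident C G) = Ident D G"

definition object_identical_isomorphism ::
  "('o, 'm::ab_group_add, 'r::comm_ring_1) lincat \<Rightarrow> ('o, 'n::ab_group_add, 'r) lincat
    \<Rightarrow> ('o \<Rightarrow> 'o \<Rightarrow> 'm \<Rightarrow> 'n) \<Rightarrow> bool"
  where "object_identical_isomorphism C D \<Phi> \<longleftrightarrow>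
    object_identical_functor C D \<Phi> \<and>
    (\<exists>\<Psi>. object_identical_functor D C \<Psi> \<and>
      (\<forall>F\<in>Obj C. \<forall>G\<in>Obj C.
        (\<forall>x\<in>Mor C F G. \<Psi> F G (\<Phi> F G x) = x) \<and>
        (\<forall>y\<in>Mor D F G. \<Phi> F G (\<Psi> F G y) = y)))"


section \<open>Free modules\<close>

definition fscale :: "'r::comm_ring_1 \<Rightarrow> ('x \<Rightarrow>\<^sub>0 'r) \<Rightarrow> ('x \<Rightarrow>\<^sub>0 'r)"
  where "fscale r x = Poly_Mapping.map (\<lambda>c. r * c) x"

abbreviation basis :: "'x \<Rightarrow> ('x \<Rightarrow>\<^sub>0 'r::comm_ring_1)"
  where "basis i \<equiv> Poly_Mapping.single i 1"

definition free_module :: "'x set \<Rightarrow> ('x \<Rightarrow>\<^sub>0 'r::comm_ring_1) set"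
  where "free_module X = {x. Poly_Mapping.keys x \<subseteq> X}"

definition linear_ext :: "('x \<Rightarrow> ('z \<Rightarrow>\<^sub>0 'r::comm_ring_1)) \<Rightarrow> ('x \<Rightarrow>\<^sub>0 'r) \<Rightarrow> ('z \<Rightarrow>\<^sub>0 'r)"
  where "linear_ext f x = (\<Sum>i\<in>Poly_Mapping.keys x. fscale (Poly_Mapping.lookup x i) (f i))"

definition bilinear_ext ::
  "('x \<Rightarrow> 'y \<Rightarrow> ('z \<Rightarrow>\<^sub>0 'r::comm_ring_1)) \<Rightarrow> ('x \<Rightarrow>\<^sub>0 'r) \<Rightarrow> ('y \<Rightarrow>\<^sub>0 'r) \<Rightarrow> ('z \<Rightarrow>\<^sub>0 'r)"
  where "bilinear_ext f x y = (\<Sum>i\<in>Poly_Mapping.keys x. \<Sum>j\<in>Poly_Mapping.keys y.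
    fscale (Poly_Mapping.lookup x i * Poly_Mapping.lookup y j) (f i j))"


section \<open>Subcharacters\<close>

type_synonym ('e, 'a) subchar = "'e set \<times> ('e \<Rightarrow> 'a)"

text \<open>
  A homomorphism with domain \<open>T\<close> is represented by a function that is \<open>undefined\<close> off \<open>T\<close>, so that
  equality of pairs is equality of subcharacters.
\<close>

definition subchars :: "'a monoid \<Rightarrow> 'e monoid \<Rightarrow> ('e, 'a) subchar set"
  where "subchars A E =
    {(T, \<tau>). subgroup T E \<and> \<tau> \<in> hom (E\<lparr>carrier := T\<rparr>) A \<and> \<tau> \<in> extensional T}"

definition conj_subchar :: "'e monoid \<Rightarrow> 'e \<Rightarrow> ('e, 'a) subchar \<Rightarrow> ('e, 'a) subchar"
  where "conj_subchar E g = (\<lambda>(T, \<tau>).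
    let T' = (\<lambda>t. g \<otimes>\<^bsub>E\<^esub> t \<otimes>\<^bsub>E\<^esub> inv\<^bsub>E\<^esub> g) ` T
    in (T', restrict (\<lambda>t. \<tau> (inv\<^bsub>E\<^esub> g \<otimes>\<^bsub>E\<^esub> t \<otimes>\<^bsub>E\<^esub> g)) T'))"

abbreviation subchar_class :: "'e monoid \<Rightarrow> ('e, 'a) subchar \<Rightarrow> ('e, 'a) subchar set"
  where "subchar_class E \<equiv> orbit E (conj_subchar E)"

definition subchar_classes :: "'a monoid \<Rightarrow> 'e monoid \<Rightarrow> ('e, 'a) subchar set set"
  where "subchar_classes A E = orbits E (subchars A E) (conj_subchar E)"

text \<open>
  For \<open>U \<le> F \<times> G\<close> and \<open>V \<le> G \<times> H\<close>, the subgroup \<open>U * V\<close> is the relational composition \<open>U O V\<close>.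
\<close>

definition Gamma_cap ::
  "'g monoid \<Rightarrow> 'g monoid \<Rightarrow> 'g monoid \<Rightarrow> ('g \<times> 'g) set \<Rightarrow> ('g \<times> 'g) set \<Rightarrow> 'g set"
  where "Gamma_cap F G H U V = {g \<in> carrier G. (\<one>\<^bsub>F\<^esub>, g) \<in> U \<and> (g, \<one>\<^bsub>H\<^esub>) \<in> V}"

definition compat :: "'a monoid \<Rightarrow> 'g monoid \<Rightarrow> 'g monoid \<Rightarrow> 'g monoid
    \<Rightarrow> ('g \<times> 'g, 'a) subchar \<Rightarrow> ('g \<times> 'g, 'a) subchar \<Rightarrow> bool"
  where "compat A F G H = (\<lambda>(U, \<mu>) (V, \<nu>).
    \<forall>g\<in>Gamma_cap F G H U V. \<mu> (\<one>\<^bsub>F\<^esub>, g) \<otimes>\<^bsub>A\<^esub> \<nu> (g, \<one>\<^bsub>H\<^esub>) = \<one>\<^bsub>A\<^esub>)"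

text \<open>The value of \<open>\<mu> * \<nu>\<close> does not depend on the chosen \<open>g\<close> when the two pairs are compatible.\<close>

definition star :: "'a monoid \<Rightarrow> ('g \<times> 'g, 'a) subchar \<Rightarrow> ('g \<times> 'g, 'a) subchar
    \<Rightarrow> ('g \<times> 'g, 'a) subchar"
  where "star A = (\<lambda>(U, \<mu>) (V, \<nu>).
    (U O V, restrict (\<lambda>(f, h). let g = (SOME g. (f, g) \<in> U \<and> (g, h) \<in> V)
                               in \<mu> (f, g) \<otimes>\<^bsub>A\<^esub> \<nu> (g, h)) (U O V)))"


section \<open>The category of subcharacters and its invariant category\<close>

definition S_mult :: "(nat \<Rightarrow> 'r::comm_ring_1) \<Rightarrow> 'a monoid
    \<Rightarrow> 'g monoid \<Rightarrow> 'g monoid \<Rightarrow> 'g monoid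
    \<Rightarrow> ('g \<times> 'g, 'a) subchar \<Rightarrow> ('g \<times> 'g, 'a) subchar \<Rightarrow> (('g \<times> 'g, 'a) subchar \<Rightarrow>\<^sub>0 'r)"
  where "S_mult l A F G H u v =
    (if compat A F G H u v
     then fscale (l (card (Gamma_cap F G H (fst u) (fst v)))) (basis (star A u v))
     else 0)"

definition twisted_diagonal :: "'a monoid \<Rightarrow> 'g monoid \<Rightarrow> 'g \<Rightarrow> ('g \<times> 'g, 'a) subchar"
  where "twisted_diagonal A G g =
    (let D = {(g \<otimes>\<^bsub>G\<^esub> y \<otimes>\<^bsub>G\<^esub> inv\<^bsub>G\<^esub> g, y) | y. y \<in> carrier G} in (D, restrict (\<lambda>_. \<one>\<^bsub>A\<^esub>) D))"

definition diagonal :: "'a monoid \<Rightarrow> 'g monoid \<Rightarrow> ('g \<times> 'g, 'a) subchar"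
  where "diagonal A G =
    (let D = {(y, y) | y. y \<in> carrier G} in (D, restrict (\<lambda>_. \<one>\<^bsub>A\<^esub>) D))"

definition S_cat :: "(nat \<Rightarrow> 'r::comm_ring_1) \<Rightarrow> 'a monoid \<Rightarrow> 'g monoid set
    \<Rightarrow> ('g monoid, ('g \<times> 'g, 'a) subchar \<Rightarrow>\<^sub>0 'r, 'r) lincat"
  where "S_cat l A \<G> = \<lparr>
    Obj = \<G>,
    Mor = (\<lambda>F G. free_module (subchars A (F \<times>\<times> G))),
    Scl = fscale,
    Comp = (\<lambda>F G H. bilinear_ext (S_mult l A F G H)),
    Ident = (\<lambda>G. basis (diagonal A G))\<rparr>"

text \<open>The group algebra of \<open>G\<close> is \<open>free_module (carrier G)\<close>.\<close>

definition \<sigma> :: "'a monoid \<Rightarrow> 'g monoid \<Rightarrow> ('g \<Rightarrow>\<^sub>0 'r::comm_ring_1)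
    \<Rightarrow> (('g \<times> 'g, 'a) subchar \<Rightarrow>\<^sub>0 'r)"
  where "\<sigma> A G = linear_ext (\<lambda>g. basis (twisted_diagonal A G g))"

definition inv_of_nat :: "nat \<Rightarrow> 'r::comm_ring_1"
  where "inv_of_nat n = (THE r. of_nat n * r = 1)"

definition trivial_idem :: "'g monoid \<Rightarrow> ('g \<Rightarrow>\<^sub>0 'r::comm_ring_1)"
  where "trivial_idem G = fscale (inv_of_nat (card (carrier G))) (\<Sum>g\<in>carrier G. basis g)"

text \<open>The inverse of \<open>\<sigma>\<^sub>G(g)\<close> is \<open>\<sigma>\<^sub>G(g\<inverse>)\<close>, as \<open>\<sigma>\<^sub>G\<close> is a homomorphism of unital algebras.\<close>

definition S_action :: "(nat \<Rightarrow> 'r::comm_ring_1) \<Rightarrow> 'a monoid \<Rightarrow> 'g monoid set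
    \<Rightarrow> 'g monoid \<Rightarrow> 'g monoid \<Rightarrow> 'g \<times> 'g
    \<Rightarrow> (('g \<times> 'g, 'a) subchar \<Rightarrow>\<^sub>0 'r) \<Rightarrow> (('g \<times> 'g, 'a) subchar \<Rightarrow>\<^sub>0 'r)"
  where "S_action l A \<G> F G = (\<lambda>(f, g) \<phi>.
    Comp (S_cat l A \<G>) F G G
      (Comp (S_cat l A \<G>) F F G (\<sigma> A F (basis f)) \<phi>)
      (\<sigma> A G (basis (inv\<^bsub>G\<^esub> g))))"

definition inv_S_cat :: "(nat \<Rightarrow> 'r::comm_ring_1) \<Rightarrow> 'a monoid \<Rightarrow> 'g monoid set
    \<Rightarrow> ('g monoid, ('g \<times> 'g, 'a) subchar \<Rightarrow>\<^sub>0 'r, 'r) lincat"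
  where "inv_S_cat l A \<G> = (S_cat l A \<G>)\<lparr>
    Mor := (\<lambda>F G. {\<phi> \<in> Mor (S_cat l A \<G>) F G.
      \<forall>x\<in>carrier (F \<times>\<times> G). S_action l A \<G> F G x \<phi> = \<phi>}),
    Ident := (\<lambda>G. \<sigma> A G (trivial_idem G))\<rparr>"

definition s_bar :: "(nat \<Rightarrow> 'r::comm_ring_1) \<Rightarrow> 'a monoid \<Rightarrow> 'g monoid set
    \<Rightarrow> 'g monoid \<Rightarrow> 'g monoid \<Rightarrow> ('g \<times> 'g, 'a) subchar \<Rightarrow> (('g \<times> 'g, 'a) subchar \<Rightarrow>\<^sub>0 'r)"
  where "s_bar l A \<G> F G u =
    Comp (S_cat l A \<G>) F G G
      (Comp (S_cat l A \<G>) F F G (\<sigma> A F (trivial_idem F)) (basis u))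
      (\<sigma> A G (trivial_idem G))"


section \<open>The fibred biset category\<close>

definition double_cosets :: "'g monoid \<Rightarrow> 'g set \<Rightarrow> 'g set \<Rightarrow> 'g set set"
  where "double_cosets G P Q = {(P #>\<^bsub>G\<^esub> g) <#>\<^bsub>G\<^esub> Q | g. g \<in> carrier G}"

text \<open>
  The product of two orbits is computed from chosen representatives of the orbits and of the
  double cosets; for subcharacters of finite groups it is independent of these choices.
\<close>

definition B_mult :: "'a monoid \<Rightarrow> 'g monoid \<Rightarrow> 'g monoid \<Rightarrow> 'g monoid
    \<Rightarrow> ('g \<times> 'g, 'a) subchar set \<Rightarrow> ('g \<times> 'g, 'a) subchar set
    \<Rightarrow> (('g \<times> 'g, 'a) subchar set \<Rightarrow>\<^sub>0 'r::comm_ring_1)"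
  where "B_mult A F G H X Y =
    (let u = (SOME u. u \<in> X); v = (SOME v. v \<in> Y)
     in \<Sum>D\<in>double_cosets G (snd ` fst u) (fst ` fst v).
          let v' = conj_subchar (G \<times>\<times> H) (SOME g. g \<in> D, \<one>\<^bsub>H\<^esub>) v
          in if compat A F G H u v'
             then basis (subchar_class (F \<times>\<times> H) (star A u v'))
             else 0)"

definition B_cat :: "'a monoid \<Rightarrow> 'g monoid set
    \<Rightarrow> ('g monoid, ('g \<times> 'g, 'a) subchar set \<Rightarrow>\<^sub>0 'r::comm_ring_1, 'r) lincat"
  where "B_cat A \<G> = \<lparr>
    Obj = \<G>,
    Mor = (\<lambda>F G. free_module (subchar_classes A (F \<times>\<times> G))),
    Scl = fscale,
    Comp = (\<lambda>F G H. bilinear_ext (B_mult A F G H)),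
    Ident = (\<lambda>G. basis (subchar_class (G \<times>\<times> G) (diagonal A G)))\<rparr>"

end

theory Submission
  imports Defs
begin

text \<open>
  Write \<open>s\<^sub>u\<close> for the basis vectors of the category of subcharacters, \<open>\<sigma>(g)\<close> for the basis vector
  of the twisted diagonal of \<open>g\<close>, and \<open>e\<^sub>G\<close> for the average of all \<open>\<sigma>(g)\<close>, \<open>g \<in> G\<close>.  The isomorphism is
  the restriction to the invariants of a map defined on the whole category of subcharacters,
  namely the linear map \<open>\<Phi>\<close> that sends \<open>s\<^sub>u\<close>, \<open>u = (U, \<mu>) \<in> \<S>(F, G)\<close>, to \<open>|U| / |G|\<close> times the class
  \<open>[u]\<close>.  As \<open>\<sigma>(f) s\<^sub>u \<sigma>(g)\<inverse>\<close> is the basis vector of the conjugate of \<open>u\<close> by \<open>(f, g)\<close>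
  (\<open>tw_basis_tw\<close>), \<open>\<Phi>\<close> does not change under \<open>\<sigma>(f) x \<sigma>(g)\<close> (\<open>Phi_tw\<close>), hence agrees on \<open>x\<close> and on its
  symmetrisation \<open>e\<^sub>F x e\<^sub>G\<close>.  Sending \<open>[u]\<close> to \<open>|G| / |U|\<close> times the symmetrisation of \<open>s\<^sub>u\<close> gives a
  map \<open>\<Psi>\<close> back for which \<open>\<Phi> \<circ> \<Psi>\<close> is the identity and \<open>\<Psi> \<circ> \<Phi>\<close> is symmetrisation, so that \<open>\<Phi>\<close> is
  bijective on invariants.

  The point is that \<open>\<Phi>\<close> respects composition.  An invariant \<open>y\<close> satisfies \<open>e\<^sub>G y = y\<close>, so by
  bilinearity it suffices to prove \<open>\<Phi>(s\<^sub>u e\<^sub>G s\<^sub>v) = \<Phi>(s\<^sub>u) \<Phi>(s\<^sub>v)\<close> for all \<open>u = (U, \<mu>)\<close> and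
  \<open>v = (V, \<nu>)\<close> (\<open>Phi_mult_basis\<close>).  The left hand side is \<open>1 / |G|\<close> times the sum over \<open>g \<in> G\<close> of
  \<open>\<Phi>(s\<^sub>u \<sigma>(g) s\<^sub>v)\<close>.  These terms are constant on double cosets \<open>D = p\<^sub>2(U) g p\<^sub>1(V)\<close>, because
  \<open>s\<^sub>u \<sigma>(p) = \<sigma>(f) s\<^sub>u\<close> for \<open>(f, p) \<in> U\<close> (\<open>summand_double_coset\<close>).  In the compatible case the term at
  \<open>g\<close> is \<open>|\<Gamma>\<^sub>\<inter>(U, V')| |U * V'| / |H|\<close> times a class, where \<open>V'\<close> is the conjugate of \<open>V\<close> by \<open>g\<close> and
  the first factor is \<open>\<ell>(|\<Gamma>\<^sub>\<inter>(U, V')|)\<close>; this is where \<open>\<ell>(n) = n\<close> enters.  The identity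
  \<open>|U| |V| = |D| |\<Gamma>\<^sub>\<inter>(U, V')| |U * V'|\<close> (\<open>card_times_double_coset\<close>) turns the sum over \<open>D\<close> into
  \<open>|U| |V| / |H|\<close> times that class, which is the summand of the product of fibred bisets.

  That both sides are categories also has to be proved.  For the category of subcharacters the
  content is associativity, which rests on a symmetric description of triple products
  (\<open>triple_cap\<close>).  The axioms for fibred bisets need no computation: they are transported
  along the bijections \<open>\<Phi>\<close> (\<open>object_identical_isomorphism_transport\<close>).
\<close>

section \<open>Free modules and bilinear extension\<close>

lemma lookup_fscale [simp]:
  "Poly_Mapping.lookup (fscale r x) i = r * Poly_Mapping.lookup x i"
  by (simp add: fscale_def Poly_Mapping.map.rep_eq when_def)

lemma module_fscale: "Modules.module fscale"
  by unfold_locales (auto intro!: poly_mapping_eqI simp: lookup_add algebra_simps)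

interpretation fscale: Modules.module fscale
  by (rule module_fscale)

lemma subspace_free_module: "fscale.subspace (free_module X)"
  by (rule fscale.subspaceI)
    (auto simp: free_module_def in_keys_iff lookup_add subset_iff, (metis add.right_neutral mult_zero_right)+)

lemma basis_in_free_module: "i \<in> X \<Longrightarrow> basis i \<in> free_module X"
  by (simp add: free_module_def)

lemma fscale_basis: "fscale r (basis i) = Poly_Mapping.single i r"
  by (rule poly_mapping_eqI) (simp add: lookup_single when_def)

lemma linear_ext_superset:
  assumes "finite S" "Poly_Mapping.keys x \<subseteq> S"
  shows "linear_ext f x = (\<Sum>i\<in>S. fscale (Poly_Mapping.lookup x i) (f i))"
  unfolding linear_ext_def using assms
  by (intro sum.mono_neutral_left) (auto simp: in_keys_iff)

lemma linear_ext_basis [simp]: "linear_ext f (basis i) = f i"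
  by (simp add: linear_ext_def)

lemma linear_ext_add: "linear_ext f (x + y) = linear_ext f x + linear_ext f y"
proof -
  let ?S = "Poly_Mapping.keys x \<union> Poly_Mapping.keys y"
  have "linear_ext f z = (\<Sum>i\<in>?S. fscale (Poly_Mapping.lookup z i) (f i))"
    if "Poly_Mapping.keys z \<subseteq> ?S" for z
    by (rule linear_ext_superset) (use that in auto)
  then show ?thesis
    using Poly_Mapping.keys_add[of x y]
    by (simp add: lookup_add fscale.scale_left_distrib sum.distrib)
qed

lemma linear_ext_scale: "linear_ext f (fscale r x) = fscale r (linear_ext f x)"
proof -
  have "linear_ext f (fscale r x)
      = (\<Sum>i\<in>Poly_Mapping.keys x. fscale (Poly_Mapping.lookup (fscale r x) i) (f i))"
    by (rule linear_ext_superset) (auto simp: in_keys_iff)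
  then show ?thesis by (simp add: linear_ext_def fscale.scale_sum_right)
qed

lemma linear_ext_hom: "module_hom fscale fscale (linear_ext f)"
  by (intro module_hom.intro module_hom_axioms.intro module_fscale linear_ext_add linear_ext_scale)

lemmas linear_ext_zero = module_hom.zero[OF linear_ext_hom]
lemmas linear_ext_sum = module_hom.sum[OF linear_ext_hom]

lemma linear_ext_in_free_module:
  assumes "x \<in> free_module X" "\<And>i. i \<in> X \<Longrightarrow> f i \<in> free_module Y"
  shows "linear_ext f x \<in> free_module Y"
  unfolding linear_ext_def using assms
  by (intro fscale.subspace_sum[OF subspace_free_module]
      fscale.subspace_scale[OF subspace_free_module]) (auto simp: free_module_def)

text \<open>Every identity between expressions that are linear in \<open>x\<close> is checked on basis vectors by
  this rule; multilinear identities are obtained by nesting it.\<close>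

lemma free_module_induct [consumes 1, case_names zero add basis]:
  assumes "x \<in> free_module X"
    and "P 0" "\<And>x y. P x \<Longrightarrow> P y \<Longrightarrow> P (x + y)"
    and "\<And>r i. i \<in> X \<Longrightarrow> P (fscale r (basis i))"
  shows "P x"
proof -
  have "P (\<Sum>i\<in>S. fscale (Poly_Mapping.lookup x i) (basis i))"
    if "finite S" "S \<subseteq> Poly_Mapping.keys x" for S
    using that
  proof (induction S rule: finite_induct)
    case (insert i S)
    then show ?case using assms by (auto simp: free_module_def)
  qed (use assms in simp)
  moreover have "(\<Sum>i\<in>Poly_Mapping.keys x. fscale (Poly_Mapping.lookup x i) (basis i)) = x"
    by (rule poly_mapping_eqI)
      (auto simp: lookup_sum lookup_single when_def fscale_basis in_keys_iff)
  ultimately show ?thesis by (metis finite_keys order_refl)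
qed

lemma bilinear_ext_eq: "bilinear_ext f x y = linear_ext (\<lambda>i. linear_ext (f i) y) x"
  by (simp add: bilinear_ext_def linear_ext_def fscale.scale_sum_right)

lemma linear_ext_fun_add:
  "linear_ext (\<lambda>i. f i + g i) x = linear_ext f x + linear_ext g x"
  by (simp add: linear_ext_def fscale.scale_right_distrib sum.distrib)

lemma linear_ext_fun_scale:
  "linear_ext (\<lambda>i. fscale r (f i)) x = fscale r (linear_ext f x)"
  by (simp add: linear_ext_def fscale.scale_sum_right mult.commute)

lemma bilinear_ext_basis [simp]: "bilinear_ext f (basis i) (basis j) = f i j"
  by (simp add: bilinear_ext_eq)

lemma bilinear_ext_left: "module_hom fscale fscale (\<lambda>x. bilinear_ext f x y)"
  unfolding bilinear_ext_eq by (rule linear_ext_hom)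

lemma bilinear_ext_right: "module_hom fscale fscale (bilinear_ext f x)"
  unfolding bilinear_ext_eq
  by (intro module_hom.intro module_hom_axioms.intro module_fscale)
    (simp_all add: linear_ext_add linear_ext_scale linear_ext_fun_add linear_ext_fun_scale)

lemmas bilinear_ext_simps =
  module_hom.add[OF bilinear_ext_left] module_hom.add[OF bilinear_ext_right]
  module_hom.scale[OF bilinear_ext_left] module_hom.scale[OF bilinear_ext_right]
  module_hom.zero[OF bilinear_ext_left] module_hom.zero[OF bilinear_ext_right]

lemma bilinear_ext_in_free_module:
  assumes "x \<in> free_module X" "y \<in> free_module Y"
    and "\<And>i j. i \<in> X \<Longrightarrow> j \<in> Y \<Longrightarrow> f i j \<in> free_module Z"
  shows "bilinear_ext f x y \<in> free_module Z"
  unfolding bilinear_ext_eq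
  by (rule linear_ext_in_free_module[OF assms(1)], rule linear_ext_in_free_module[OF assms(2)])
    (rule assms(3))

lemma of_nat_inv_of_nat:
  assumes "(of_nat n :: 'r::comm_ring_1) dvd 1"
  shows "of_nat n * (inv_of_nat n :: 'r) = 1"
proof -
  obtain r :: 'r where r: "of_nat n * r = 1" using assms by (metis dvdE)
  have "r' = r" if "of_nat n * r' = 1" for r'
    using r that by (metis mult.commute mult.left_commute mult.right_neutral)
  with r have "\<exists>!r::'r. of_nat n * r = 1" by auto
  then show ?thesis unfolding inv_of_nat_def by (rule theI')
qed

section \<open>Transport of a linear category along bijections\<close>

text \<open>Of the target only its module structure and its operations are given; each of its axioms is the
  image of the same axiom of \<open>C\<close>, since every morphism of \<open>D\<close> has the form \<open>\<Phi> F G x\<close>.  Linearity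
  and functoriality of \<open>\<Psi>\<close> follow in the same way.\<close>

lemma object_identical_isomorphism_transport:
  fixes C :: "('o, 'm::ab_group_add, 'r::comm_ring_1) lincat"
    and D :: "('o, 'n::ab_group_add, 'r) lincat"
  assumes C: "linear_category C" and D: "Modules.module (Scl D)" and obj: "Obj C = Obj D"
    and cl: "\<And>F G x. \<lbrakk>F \<in> Obj C; G \<in> Obj C; x \<in> Mor C F G\<rbrakk> \<Longrightarrow> \<Phi> F G x \<in> Mor D F G"
    and add: "\<And>F G x y. \<lbrakk>F \<in> Obj C; G \<in> Obj C; x \<in> Mor C F G; y \<in> Mor C F G\<rbrakk>
      \<Longrightarrow> \<Phi> F G (x + y) = \<Phi> F G x + \<Phi> F G y"
    and scl: "\<And>F G r x. \<lbrakk>F \<in> Obj C; G \<in> Obj C; x \<in> Mor C F G\<rbrakk>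
      \<Longrightarrow> \<Phi> F G (Scl C r x) = Scl D r (\<Phi> F G x)"
    and cmp: "\<And>F G H x y. \<lbrakk>F \<in> Obj C; G \<in> Obj C; H \<in> Obj C; x \<in> Mor C F G; y \<in> Mor C G H\<rbrakk>
      \<Longrightarrow> Comp D F G H (\<Phi> F G x) (\<Phi> G H y) = \<Phi> F H (Comp C F G H x y)"
    and idn: "\<And>G. G \<in> Obj C \<Longrightarrow> Ident D G = \<Phi> G G (Ident C G)"
    and inv_cl: "\<And>F G y. \<lbrakk>F \<in> Obj C; G \<in> Obj C; y \<in> Mor D F G\<rbrakk> \<Longrightarrow> \<Psi> F G y \<in> Mor C F G"
    and inv_l: "\<And>F G x. \<lbrakk>F \<in> Obj C; G \<in> Obj C; x \<in> Mor C F G\<rbrakk> \<Longrightarrow> \<Psi> F G (\<Phi> F G x) = x"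
    and inv_r: "\<And>F G y. \<lbrakk>F \<in> Obj C; G \<in> Obj C; y \<in> Mor D F G\<rbrakk> \<Longrightarrow> \<Phi> F G (\<Psi> F G y) = y"
  shows "object_identical_isomorphism C D \<Phi>"
proof -
  interpret C: linear_category C by fact
  interpret D: Modules.module "Scl D" by fact
  have im: "Mor D F G = \<Phi> F G ` Mor C F G" if "F \<in> Obj C" "G \<in> Obj C" for F G
    using cl[OF that] inv_cl[OF that] inv_r[OF that] by (force simp: image_iff)
  have C_add: "x + y \<in> Mor C F G" if "F \<in> Obj C" "G \<in> Obj C" "x \<in> Mor C F G" "y \<in> Mor C F G" for F G x y
    using C.subspace_add[OF C.Mor_submodule] that by auto
  have C_scl: "Scl C r x \<in> Mor C F G" if "F \<in> Obj C" "G \<in> Obj C" "x \<in> Mor C F G" for F G r x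
    using C.subspace_scale[OF C.Mor_submodule] that by auto
  have sub: "D.subspace (Mor D F G)" if "F \<in> Obj C" "G \<in> Obj C" for F G
  proof (rule D.subspaceI)
    have z: "0 \<in> Mor C F G" by (rule C.subspace_0[OF C.Mor_submodule[OF that]])
    have "\<Phi> F G 0 = 0" using scl[OF that z, of 0] by simp
    then show "0 \<in> Mor D F G" using cl[OF that z] by simp
  qed (use that in \<open>auto simp: im simp flip: add scl intro!: imageI C_add C_scl\<close>)
  have lin: "linear_category D"
  proof (intro linear_category.intro linear_category_axioms.intro D, unfold obj[symmetric])
    fix F G assume "F \<in> Obj C" "G \<in> Obj C"
    then show "D.subspace (Mor D F G)" by (rule sub)
  qed (auto simp: im add[symmetric] scl[symmetric] cmp idn C.Comp_closed C.Comp_add_left C.Comp_add_right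
      C.Comp_scale_left C.Comp_scale_right C.Comp_assoc C_add C_scl C.Ident_closed C.Comp_Ident_left
      C.Comp_Ident_right)
  have "object_identical_functor C D \<Phi>"
    by (intro object_identical_functor.intro object_identical_functor_axioms.intro C lin)
      (simp_all add: obj[symmetric] cl add scl cmp idn)
  moreover have "object_identical_functor D C \<Psi>"
    by (intro object_identical_functor.intro object_identical_functor_axioms.intro C lin)
      (auto simp: im inv_l add[symmetric] scl[symmetric] cmp idn C.Comp_closed C_add C_scl
        C.Ident_closed simp flip: obj)
  ultimately show ?thesis
    unfolding object_identical_isomorphism_def using inv_l inv_r by auto
qed

section \<open>Subcharacters\<close>

lemma subcharsD:
  assumes "(T, \<tau>) \<in> subchars A E"
  shows "subgroup T E" "x \<in> T \<Longrightarrow> \<tau> x \<in> carrier A"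
    "x \<in> T \<Longrightarrow> y \<in> T \<Longrightarrow> \<tau> (x \<otimes>\<^bsub>E\<^esub> y) = \<tau> x \<otimes>\<^bsub>A\<^esub> \<tau> y" "\<tau> \<in> extensional T"
  using assms by (auto simp: subchars_def hom_def Pi_iff)

lemma subcharsI:
  assumes "subgroup T E" "\<And>x. x \<in> T \<Longrightarrow> \<tau> x \<in> carrier A"
    "\<And>x y. x \<in> T \<Longrightarrow> y \<in> T \<Longrightarrow> \<tau> (x \<otimes>\<^bsub>E\<^esub> y) = \<tau> x \<otimes>\<^bsub>A\<^esub> \<tau> y" "\<tau> \<in> extensional T"
  shows "(T, \<tau>) \<in> subchars A E"
  using assms by (auto simp: subchars_def hom_def Pi_iff)

lemma subchar_one:
  assumes "group A" "group E" "(T, \<tau>) \<in> subchars A E"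
  shows "\<tau> \<one>\<^bsub>E\<^esub> = \<one>\<^bsub>A\<^esub>"
proof -
  interpret A: group A by fact
  interpret E: group E by fact
  have one: "\<one>\<^bsub>E\<^esub> \<in> T" using subcharsD(1)[OF assms(3)] by (rule subgroup.one_closed)
  show ?thesis
    using subcharsD(3)[OF assms(3) one one] subcharsD(2)[OF assms(3) one]
    by (metis A.l_cancel_one E.l_one E.one_closed)
qed

lemma subchar_inv:
  assumes "group A" "group E" "(T, \<tau>) \<in> subchars A E" "x \<in> T"
  shows "\<tau> (inv\<^bsub>E\<^esub> x) = inv\<^bsub>A\<^esub> (\<tau> x)"
proof -
  interpret A: group A by fact
  interpret E: group E by fact
  interpret T: subgroup T E using subcharsD(1)[OF assms(3)] .
  note D = subcharsD[OF assms(3)]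
  have "\<tau> (inv\<^bsub>E\<^esub> x) \<otimes>\<^bsub>A\<^esub> \<tau> x = \<one>\<^bsub>A\<^esub>"
    using D(3)[of "inv\<^bsub>E\<^esub> x" x] assms(4) subchar_one[OF assms(1-3)] by simp
  then show ?thesis using D(2) assms(4) by (metis A.inv_equality T.m_inv_closed)
qed

text \<open>In terms of preimages under conjugation, the subgroup and its character are described by the
  same formula, and the action law becomes \<open>(g h)\<inverse> x (g h) = h\<inverse> (g\<inverse> x g) h\<close>.\<close>

lemma conj_subchar_eq:
  assumes "group E" "g \<in> carrier E" "T \<subseteq> carrier E"
  shows "conj_subchar E g (T, \<tau>)
    = (let T' = {x \<in> carrier E. inv\<^bsub>E\<^esub> g \<otimes>\<^bsub>E\<^esub> x \<otimes>\<^bsub>E\<^esub> g \<in> T}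
       in (T', restrict (\<lambda>x. \<tau> (inv\<^bsub>E\<^esub> g \<otimes>\<^bsub>E\<^esub> x \<otimes>\<^bsub>E\<^esub> g)) T'))"
proof -
  interpret E: group E by fact
  have "(\<lambda>t. g \<otimes>\<^bsub>E\<^esub> t \<otimes>\<^bsub>E\<^esub> inv\<^bsub>E\<^esub> g) ` T = {x \<in> carrier E. inv\<^bsub>E\<^esub> g \<otimes>\<^bsub>E\<^esub> x \<otimes>\<^bsub>E\<^esub> g \<in> T}"
  proof (intro equalityI subsetI)
    fix x assume "x \<in> (\<lambda>t. g \<otimes>\<^bsub>E\<^esub> t \<otimes>\<^bsub>E\<^esub> inv\<^bsub>E\<^esub> g) ` T"
    then show "x \<in> {x \<in> carrier E. inv\<^bsub>E\<^esub> g \<otimes>\<^bsub>E\<^esub> x \<otimes>\<^bsub>E\<^esub> g \<in> T}"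
      using assms E.inv_solve_left' by (auto simp: E.m_assoc subset_iff) (simp flip: E.m_assoc add: subset_iff)
  next
    fix x assume "x \<in> {x \<in> carrier E. inv\<^bsub>E\<^esub> g \<otimes>\<^bsub>E\<^esub> x \<otimes>\<^bsub>E\<^esub> g \<in> T}"
    then show "x \<in> (\<lambda>t. g \<otimes>\<^bsub>E\<^esub> t \<otimes>\<^bsub>E\<^esub> inv\<^bsub>E\<^esub> g) ` T"
      using assms by (intro image_eqI[of _ _ "inv\<^bsub>E\<^esub> g \<otimes>\<^bsub>E\<^esub> x \<otimes>\<^bsub>E\<^esub> g"])
        (auto simp: E.m_assoc, simp flip: E.m_assoc)
  qed
  then show ?thesis by (simp add: conj_subchar_def Let_def)
qed

lemma conj_subchar_in:
  assumes "group E" "g \<in> carrier E" "u \<in> subchars A E"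
  shows "conj_subchar E g u \<in> subchars A E"
proof -
  interpret E: group E by fact
  obtain T \<tau> where u: "u = (T, \<tau>)" by (cases u)
  note D = subcharsD[OF assms(3)[unfolded u]]
  interpret T: subgroup T E using D(1) .
  have m: "inv\<^bsub>E\<^esub> g \<otimes>\<^bsub>E\<^esub> (x \<otimes>\<^bsub>E\<^esub> y) \<otimes>\<^bsub>E\<^esub> g
      = (inv\<^bsub>E\<^esub> g \<otimes>\<^bsub>E\<^esub> x \<otimes>\<^bsub>E\<^esub> g) \<otimes>\<^bsub>E\<^esub> (inv\<^bsub>E\<^esub> g \<otimes>\<^bsub>E\<^esub> y \<otimes>\<^bsub>E\<^esub> g)"
    if "x \<in> carrier E" "y \<in> carrier E" for x y
    using that assms(2) by (simp add: E.m_assoc E.inv_solve_left') (simp flip: E.m_assoc)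
  have i: "inv\<^bsub>E\<^esub> g \<otimes>\<^bsub>E\<^esub> inv\<^bsub>E\<^esub> x \<otimes>\<^bsub>E\<^esub> g = inv\<^bsub>E\<^esub> (inv\<^bsub>E\<^esub> g \<otimes>\<^bsub>E\<^esub> x \<otimes>\<^bsub>E\<^esub> g)"
    if "x \<in> carrier E" for x
    using that assms(2) by (simp add: E.inv_mult_group E.m_assoc)
  show ?thesis unfolding u conj_subchar_eq[OF assms(1,2) T.subset] Let_def
  proof (rule subcharsI)
    show "subgroup {x \<in> carrier E. inv\<^bsub>E\<^esub> g \<otimes>\<^bsub>E\<^esub> x \<otimes>\<^bsub>E\<^esub> g \<in> T} E"
      by (rule E.subgroupI) (use assms(2) in \<open>auto simp: m i intro!: exI[of _ "\<one>\<^bsub>E\<^esub>"]\<close>)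
  qed (use assms(2) D in \<open>auto simp: m i\<close>)
qed

lemma conj_subchar_mult:
  assumes "group E" "g \<in> carrier E" "h \<in> carrier E" "u \<in> subchars A E"
  shows "conj_subchar E g (conj_subchar E h u) = conj_subchar E (g \<otimes>\<^bsub>E\<^esub> h) u"
proof -
  interpret E: group E by fact
  obtain T \<tau> where u: "u = (T, \<tau>)" by (cases u)
  have T: "T \<subseteq> carrier E"
    using subcharsD(1)[OF assms(4)[unfolded u]] by (rule subgroup.subset)
  have "inv\<^bsub>E\<^esub> (g \<otimes>\<^bsub>E\<^esub> h) \<otimes>\<^bsub>E\<^esub> x \<otimes>\<^bsub>E\<^esub> (g \<otimes>\<^bsub>E\<^esub> h)
      = inv\<^bsub>E\<^esub> h \<otimes>\<^bsub>E\<^esub> (inv\<^bsub>E\<^esub> g \<otimes>\<^bsub>E\<^esub> x \<otimes>\<^bsub>E\<^esub> g) \<otimes>\<^bsub>E\<^esub> h"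
    if "x \<in> carrier E" for x
    using assms that by (simp add: E.inv_mult_group E.m_assoc)
  then show ?thesis
    unfolding u using assms T
    by (subst conj_subchar_eq, simp, simp, simp)+
      (auto simp: Let_def conj_subchar_eq[OF assms(1)] restrict_def fun_eq_iff)
qed

lemma conj_subchar_one:
  assumes "group E" "u \<in> subchars A E"
  shows "conj_subchar E \<one>\<^bsub>E\<^esub> u = u"
proof -
  interpret E: group E by fact
  obtain T \<tau> where u: "u = (T, \<tau>)" by (cases u)
  note D = subcharsD[OF assms(2)[unfolded u]]
  interpret T: subgroup T E using D(1) .
  have "{x \<in> carrier E. inv\<^bsub>E\<^esub> \<one>\<^bsub>E\<^esub> \<otimes>\<^bsub>E\<^esub> x \<otimes>\<^bsub>E\<^esub> \<one>\<^bsub>E\<^esub> \<in> T} = T" by auto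
  moreover have "restrict (\<lambda>x. \<tau> (inv\<^bsub>E\<^esub> \<one>\<^bsub>E\<^esub> \<otimes>\<^bsub>E\<^esub> x \<otimes>\<^bsub>E\<^esub> \<one>\<^bsub>E\<^esub>)) T = \<tau>"
    using D(4) by (auto simp: restrict_def fun_eq_iff extensional_def)
  ultimately show ?thesis
    unfolding u conj_subchar_eq[OF assms(1) E.one_closed T.subset] Let_def by simp
qed

text \<open>Since \<open>A\<close> is abelian, \<open>\<tau>(t\<inverse> x t) = \<tau>(x)\<close> for \<open>t, x \<in> T\<close>.\<close>

lemma conj_subchar_self:
  assumes "comm_group A" "group E" "(T, \<tau>) \<in> subchars A E" "t \<in> T"
  shows "conj_subchar E t (T, \<tau>) = (T, \<tau>)"
proof -
  interpret A: comm_group A by fact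
  interpret E: group E by fact
  note D = subcharsD[OF assms(3)]
  interpret T: subgroup T E using D(1) .
  have t: "t \<in> carrier E" using assms(4) T.subset by auto
  have "x \<in> T" if "x \<in> carrier E" "inv\<^bsub>E\<^esub> t \<otimes>\<^bsub>E\<^esub> x \<otimes>\<^bsub>E\<^esub> t \<in> T" for x
  proof -
    have "t \<otimes>\<^bsub>E\<^esub> (inv\<^bsub>E\<^esub> t \<otimes>\<^bsub>E\<^esub> x \<otimes>\<^bsub>E\<^esub> t) \<otimes>\<^bsub>E\<^esub> inv\<^bsub>E\<^esub> t \<in> T" using that assms(4) by simp
    also have "t \<otimes>\<^bsub>E\<^esub> (inv\<^bsub>E\<^esub> t \<otimes>\<^bsub>E\<^esub> x \<otimes>\<^bsub>E\<^esub> t) \<otimes>\<^bsub>E\<^esub> inv\<^bsub>E\<^esub> t = x"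
      using that(1) t by (simp add: E.m_assoc) (simp flip: E.m_assoc)
    finally show ?thesis .
  qed
  then have eq: "{x \<in> carrier E. inv\<^bsub>E\<^esub> t \<otimes>\<^bsub>E\<^esub> x \<otimes>\<^bsub>E\<^esub> t \<in> T} = T"
    using assms(4) T.subset by blast
  have "\<tau> (inv\<^bsub>E\<^esub> t \<otimes>\<^bsub>E\<^esub> x \<otimes>\<^bsub>E\<^esub> t) = \<tau> x" if "x \<in> T" for x
    using that assms(4) D(2)
    by (simp add: D(3) subchar_inv[OF A.is_group assms(2,3)] A.m_assoc A.m_comm[of "\<tau> x" "\<tau> t"])
      (simp flip: A.m_assoc)
  then have "restrict (\<lambda>x. \<tau> (inv\<^bsub>E\<^esub> t \<otimes>\<^bsub>E\<^esub> x \<otimes>\<^bsub>E\<^esub> t)) T = \<tau>"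
    using D(4) by (auto simp: restrict_def fun_eq_iff extensional_def)
  then show ?thesis
    unfolding conj_subchar_eq[OF assms(2) t T.subset] Let_def eq by simp
qed

lemma card_conj_subchar:
  assumes "group E" "g \<in> carrier E" "u \<in> subchars A E"
  shows "card (fst (conj_subchar E g u)) = card (fst u)"
proof -
  interpret E: group E by fact
  obtain T \<tau> where u: "u = (T, \<tau>)" by (cases u)
  have "T \<subseteq> carrier E" using subcharsD(1)[OF assms(3)[unfolded u]] by (rule subgroup.subset)
  then have "inj_on (\<lambda>t. g \<otimes>\<^bsub>E\<^esub> t \<otimes>\<^bsub>E\<^esub> inv\<^bsub>E\<^esub> g) T"
    using assms(2) by (auto intro!: inj_onI simp: subset_iff)
  then show ?thesis by (simp add: u conj_subchar_def Let_def card_image)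
qed

lemma subchar_class_refl:
  assumes "group E" "u \<in> subchars A E"
  shows "u \<in> subchar_class E u"
  using conj_subchar_one[OF assms] group.is_monoid[OF assms(1), THEN monoid.one_closed]
  unfolding orbit_def by force

lemma subchar_class_conj:
  assumes "group E" "g \<in> carrier E" "u \<in> subchars A E"
  shows "subchar_class E (conj_subchar E g u) = subchar_class E u"
proof -
  interpret E: group E by fact
  have "subchar_class E (conj_subchar E g u) \<subseteq> subchar_class E u"
    if "g \<in> carrier E" "u \<in> subchars A E" for g u
    using that by (auto simp: orbit_def conj_subchar_mult[OF assms(1)])
  from this[OF assms(2,3)] this[of "inv\<^bsub>E\<^esub> g" "conj_subchar E g u"]
  show ?thesis using assms conj_subchar_in[OF assms]
    by (simp add: conj_subchar_mult[OF assms(1), where A=A] conj_subchar_one[OF assms(1), where A=A])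
qed

section \<open>The product of subcharacters\<close>

lemma card_eq_card_image_times:
  assumes "finite S" "\<And>b. b \<in> f ` S \<Longrightarrow> card {a \<in> S. f a = b} = k"
  shows "card S = card (f ` S) * k"
  using sum.image_gen[OF assms(1), of "\<lambda>_. 1 :: nat" f] assms by simp

text \<open>Multiplicativity of \<open>l\<close> is what makes composition of subcharacters associative, and \<open>l 1 = 1\<close>
  lets twisted diagonals act by conjugation.\<close>

locale fibred_groups =
  fixes \<G> :: "'g monoid set" and A :: "'a monoid" and l :: "nat \<Rightarrow> 'r::comm_ring_1"
  assumes group_obj: "G \<in> \<G> \<Longrightarrow> group G"
    and finite_obj: "G \<in> \<G> \<Longrightarrow> finite (carrier G)"
    and comm_group_A: "comm_group A"
    and l_one: "l 1 = 1"
    and l_mult: "\<lbrakk>m > 0; n > 0\<rbrakk> \<Longrightarrow> l (m * n) = l m * l n"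
begin

sublocale A: comm_group A
  by (rule comm_group_A)

abbreviation "Sub F G \<equiv> subchars A (F \<times>\<times> G)"

lemma group_prod: "F \<in> \<G> \<Longrightarrow> G \<in> \<G> \<Longrightarrow> group (F \<times>\<times> G)"
  by (intro DirProd_group group_obj)

lemma subchar_carrier:
  assumes "(U, \<mu>) \<in> Sub F G" "(f, g) \<in> U"
  shows "f \<in> carrier F" "g \<in> carrier G"
  using subgroup.subset[OF subcharsD(1)[OF assms(1)]] assms(2) by auto

lemma subchar_value: "(U, \<mu>) \<in> Sub F G \<Longrightarrow> (f, g) \<in> U \<Longrightarrow> \<mu> (f, g) \<in> carrier A"
  by (rule subcharsD(2))

lemma subchar_mult:
  assumes "(U, \<mu>) \<in> Sub F G" "(f, g) \<in> U" "(f', g') \<in> U"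
  shows "(f \<otimes>\<^bsub>F\<^esub> f', g \<otimes>\<^bsub>G\<^esub> g') \<in> U"
    "\<mu> (f \<otimes>\<^bsub>F\<^esub> f', g \<otimes>\<^bsub>G\<^esub> g') = \<mu> (f, g) \<otimes>\<^bsub>A\<^esub> \<mu> (f', g')"
  using subgroup.m_closed[OF subcharsD(1)[OF assms(1)] assms(2,3)]
    subcharsD(3)[OF assms(1-3)] by simp_all

lemma subchar_inverse:
  assumes "F \<in> \<G>" "G \<in> \<G>" "(U, \<mu>) \<in> Sub F G" "(f, g) \<in> U"
  shows "(inv\<^bsub>F\<^esub> f, inv\<^bsub>G\<^esub> g) \<in> U"
    "\<mu> (inv\<^bsub>F\<^esub> f, inv\<^bsub>G\<^esub> g) = inv\<^bsub>A\<^esub> \<mu> (f, g)"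
  using subgroup.m_inv_closed[OF subcharsD(1)[OF assms(3)] assms(4)]
    subchar_inv[OF A.is_group group_prod[OF assms(1,2)] assms(3,4)]
    subchar_carrier[OF assms(3,4)] group_obj[OF assms(1)] group_obj[OF assms(2)]
  by simp_all

lemma subchar_unit:
  assumes "F \<in> \<G>" "G \<in> \<G>" "(U, \<mu>) \<in> Sub F G"
  shows "(\<one>\<^bsub>F\<^esub>, \<one>\<^bsub>G\<^esub>) \<in> U" "\<mu> (\<one>\<^bsub>F\<^esub>, \<one>\<^bsub>G\<^esub>) = \<one>\<^bsub>A\<^esub>"
  using subgroup.one_closed[OF subcharsD(1)[OF assms(3)]]
    subchar_one[OF A.is_group group_prod[OF assms(1,2)] assms(3)] by simp_all

lemma finite_subchar:
  assumes "F \<in> \<G>" "G \<in> \<G>" "(U, \<mu>) \<in> Sub F G"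
  shows "finite U"
  using subgroup.subset[OF subcharsD(1)[OF assms(3)]] finite_obj[OF assms(1)] finite_obj[OF assms(2)]
  by (auto intro: finite_subset)

lemma middle_quotient:
  assumes "F \<in> \<G>" "G \<in> \<G>" "H \<in> \<G>" "(U, \<mu>) \<in> Sub F G" "(V, \<nu>) \<in> Sub G H"
    and "(f, g) \<in> U" "(g, h) \<in> V" "(f, g') \<in> U" "(g', h) \<in> V"
  shows "inv\<^bsub>G\<^esub> g \<otimes>\<^bsub>G\<^esub> g' \<in> Gamma_cap F G H U V"
proof -
  interpret F: group F by (rule group_obj[OF assms(1)])
  interpret G: group G by (rule group_obj[OF assms(2)])
  interpret H: group H by (rule group_obj[OF assms(3)])
  show ?thesis
    using subchar_mult(1)[OF assms(4) subchar_inverse(1)[OF assms(1,2,4,6)] assms(8)]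
      subchar_mult(1)[OF assms(5) subchar_inverse(1)[OF assms(2,3,5,7)] assms(9)]
      subchar_carrier[OF assms(4,6)] subchar_carrier[OF assms(5,7)] subchar_carrier[OF assms(5,9)]
    by (simp add: Gamma_cap_def)
qed

text \<open>By compatibility the pairs \<open>(1, k) \<in> U\<close> and \<open>(k, 1) \<in> V\<close>, where \<open>g' = g k\<close>, contribute
  inverse values, so that the value of \<open>\<mu> * \<nu>\<close> is the same for every middle element.\<close>

lemma compat_path_independent:
  assumes "F \<in> \<G>" "G \<in> \<G>" "H \<in> \<G>" "(U, \<mu>) \<in> Sub F G" "(V, \<nu>) \<in> Sub G H"
    and "(f, g) \<in> U" "(g, h) \<in> V" "(f, g') \<in> U" "(g', h) \<in> V"
    and "compat A F G H (U, \<mu>) (V, \<nu>)"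
  shows "\<mu> (f, g) \<otimes>\<^bsub>A\<^esub> \<nu> (g, h) = \<mu> (f, g') \<otimes>\<^bsub>A\<^esub> \<nu> (g', h)"
proof -
  interpret F: group F by (rule group_obj[OF assms(1)])
  interpret G: group G by (rule group_obj[OF assms(2)])
  interpret H: group H by (rule group_obj[OF assms(3)])
  note c = subchar_carrier[OF assms(4,6)] subchar_carrier[OF assms(5,7)] subchar_carrier[OF assms(5,9)]
  define k where "k = inv\<^bsub>G\<^esub> g \<otimes>\<^bsub>G\<^esub> g'"
  have k: "k \<in> Gamma_cap F G H U V"
    unfolding k_def by (rule middle_quotient[OF assms(1-9)])
  then have kU: "(\<one>\<^bsub>F\<^esub>, k) \<in> U" and kV: "(k, \<one>\<^bsub>H\<^esub>) \<in> V" by (auto simp: Gamma_cap_def)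
  have gk: "g \<otimes>\<^bsub>G\<^esub> k = g'" using c by (simp add: k_def flip: G.m_assoc)
  have \<mu>: "\<mu> (f, g') = \<mu> (f, g) \<otimes>\<^bsub>A\<^esub> \<mu> (\<one>\<^bsub>F\<^esub>, k)"
    using subchar_mult(2)[OF assms(4,6) kU] c gk by simp
  have \<nu>: "\<nu> (g', h) = \<nu> (k, \<one>\<^bsub>H\<^esub>) \<otimes>\<^bsub>A\<^esub> \<nu> (g, h)"
    using subchar_mult(2)[OF assms(5,7) kV] c gk
      subchar_value[OF assms(5,7)] subchar_value[OF assms(5) kV] by (simp add: A.m_comm)
  have "\<mu> (f, g') \<otimes>\<^bsub>A\<^esub> \<nu> (g', h)
      = \<mu> (f, g) \<otimes>\<^bsub>A\<^esub> (\<mu> (\<one>\<^bsub>F\<^esub>, k) \<otimes>\<^bsub>A\<^esub> \<nu> (k, \<one>\<^bsub>H\<^esub>)) \<otimes>\<^bsub>A\<^esub> \<nu> (g, h)"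
    unfolding \<mu> \<nu>
    using subchar_value[OF assms(4,6)] subchar_value[OF assms(4) kU]
      subchar_value[OF assms(5,7)] subchar_value[OF assms(5) kV] by (simp add: A.m_assoc)
  moreover have "\<mu> (\<one>\<^bsub>F\<^esub>, k) \<otimes>\<^bsub>A\<^esub> \<nu> (k, \<one>\<^bsub>H\<^esub>) = \<one>\<^bsub>A\<^esub>"
    using assms(10) k by (auto simp: compat_def)
  ultimately show ?thesis using subchar_value[OF assms(4,6)] by simp
qed

lemma fst_star [simp]: "fst (star A (U, \<mu>) (V, \<nu>)) = U O V"
  by (simp add: star_def)

lemma snd_star:
  assumes "F \<in> \<G>" "G \<in> \<G>" "H \<in> \<G>" "(U, \<mu>) \<in> Sub F G" "(V, \<nu>) \<in> Sub G H"
    and "compat A F G H (U, \<mu>) (V, \<nu>)" "(f, g) \<in> U" "(g, h) \<in> V"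
  shows "snd (star A (U, \<mu>) (V, \<nu>)) (f, h) = \<mu> (f, g) \<otimes>\<^bsub>A\<^esub> \<nu> (g, h)"
proof -
  let ?g = "SOME g. (f, g) \<in> U \<and> (g, h) \<in> V"
  have "(f, ?g) \<in> U \<and> (?g, h) \<in> V" using assms(7,8) by (intro someI[of "\<lambda>g. (f, g) \<in> U \<and> (g, h) \<in> V" g]) simp
  then have "\<mu> (f, ?g) \<otimes>\<^bsub>A\<^esub> \<nu> (?g, h) = \<mu> (f, g) \<otimes>\<^bsub>A\<^esub> \<nu> (g, h)"
    using compat_path_independent[OF assms(1-5)] assms(6-8) by blast
  then show ?thesis using assms(7,8) by (auto simp: star_def Let_def)
qed

lemma star_in:
  assumes "F \<in> \<G>" "G \<in> \<G>" "H \<in> \<G>" "u \<in> Sub F G" "v \<in> Sub G H"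
    and "compat A F G H u v"
  shows "star A u v \<in> Sub F H"
proof -
  obtain U \<mu> V \<nu> where uv: "u = (U, \<mu>)" "v = (V, \<nu>)" by fastforce
  note a = assms(4,5)[unfolded uv]
  note val = snd_star[OF assms(1-3) a assms(6)[unfolded uv]]
  interpret FH: group "F \<times>\<times> H" using assms by (intro group_prod)
  define \<rho> where "\<rho> = snd (star A u v)"
  have val: "\<rho> (f, h) = \<mu> (f, g) \<otimes>\<^bsub>A\<^esub> \<nu> (g, h)" if "(f, g) \<in> U" "(g, h) \<in> V" for f g h
    using val[OF that] by (simp add: \<rho>_def uv)
  have eq: "star A u v = (U O V, \<rho>)" by (simp add: \<rho>_def uv prod_eq_iff)
  show ?thesis unfolding eq
  proof (rule subcharsI)
    show "subgroup (U O V) (F \<times>\<times> H)"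
    proof (rule FH.subgroupI)
      show "U O V \<subseteq> carrier (F \<times>\<times> H)"
        using subchar_carrier[OF a(1)] subchar_carrier[OF a(2)] by auto
      show "U O V \<noteq> {}"
        using subchar_unit(1)[OF assms(1,2) a(1)] subchar_unit(1)[OF assms(2,3) a(2)] by blast
      show "inv\<^bsub>F \<times>\<times> H\<^esub> x \<in> U O V" if "x \<in> U O V" for x
        using that
      proof (rule relcompE)
        fix f g h assume x: "x = (f, h)" and p: "(f, g) \<in> U" "(g, h) \<in> V"
        then show ?thesis
          using subchar_inverse(1)[OF assms(1,2) a(1) p(1)] subchar_inverse(1)[OF assms(2,3) a(2) p(2)]
            subchar_carrier[OF a(1) p(1)] subchar_carrier[OF a(2) p(2)]
            group_obj[OF assms(1)] group_obj[OF assms(3)]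
          by auto
      qed
      show "x \<otimes>\<^bsub>F \<times>\<times> H\<^esub> y \<in> U O V" if "x \<in> U O V" "y \<in> U O V" for x y
        using that by (auto dest: subchar_mult(1)[OF a(1)] subchar_mult(1)[OF a(2)])
          (blast intro: subchar_mult(1)[OF a(1)] subchar_mult(1)[OF a(2)])
    qed
    show "\<rho> x \<in> carrier A" if "x \<in> U O V" for x
      using that by (auto simp: val subchar_value[OF a(1)] subchar_value[OF a(2)])
    show "\<rho> (x \<otimes>\<^bsub>F \<times>\<times> H\<^esub> y) = \<rho> x \<otimes>\<^bsub>A\<^esub> \<rho> y" if "x \<in> U O V" "y \<in> U O V" for x y
    proof -
      obtain f g h where x: "x = (f, h)" and p: "(f, g) \<in> U" "(g, h) \<in> V" using \<open>x \<in> U O V\<close> by auto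
      obtain f' g' h' where y: "y = (f', h')" and q: "(f', g') \<in> U" "(g', h') \<in> V"
        using \<open>y \<in> U O V\<close> by auto
      show ?thesis
        using val[OF subchar_mult(1)[OF a(1) p(1) q(1)] subchar_mult(1)[OF a(2) p(2) q(2)]]
          subchar_mult(2)[OF a(1) p(1) q(1)] subchar_mult(2)[OF a(2) p(2) q(2)]
          subchar_value[OF a(1) p(1)] subchar_value[OF a(1) q(1)]
          subchar_value[OF a(2) p(2)] subchar_value[OF a(2) q(2)]
        by (simp add: x y val[OF p] val[OF q] A.m_ac)
    qed
    show "\<rho> \<in> extensional (U O V)"
      by (simp add: \<rho>_def uv star_def)
  qed
qed

lemma Gamma_cap_finite: "G \<in> \<G> \<Longrightarrow> finite (Gamma_cap F G H U V)"
  using finite_obj by (auto simp: Gamma_cap_def intro: finite_subset)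

lemma card_Gamma_cap_pos:
  assumes "F \<in> \<G>" "G \<in> \<G>" "H \<in> \<G>" "(U, \<mu>) \<in> Sub F G" "(V, \<nu>) \<in> Sub G H"
  shows "card (Gamma_cap F G H U V) > 0"
proof -
  have "\<one>\<^bsub>G\<^esub> \<in> Gamma_cap F G H U V"
    using subchar_unit(1)[OF assms(1,2,4)] subchar_unit(1)[OF assms(2,3,5)]
    by (auto simp: Gamma_cap_def dest: subchar_carrier(2)[OF assms(4)])
  then show ?thesis using Gamma_cap_finite[OF assms(2)] card_gt_0_iff by blast
qed

text \<open>The middle elements joining two given endpoints form a coset of \<open>\<Gamma>\<^sub>\<inter>(U, V)\<close>.\<close>

lemma card_middle:
  assumes "F \<in> \<G>" "G \<in> \<G>" "H \<in> \<G>" "(U, \<mu>) \<in> Sub F G" "(V, \<nu>) \<in> Sub G H"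
    and "(f, h) \<in> U O V"
  shows "card {g. (f, g) \<in> U \<and> (g, h) \<in> V} = card (Gamma_cap F G H U V)"
proof -
  interpret F: group F by (rule group_obj[OF assms(1)])
  interpret G: group G by (rule group_obj[OF assms(2)])
  interpret H: group H by (rule group_obj[OF assms(3)])
  obtain g where g: "(f, g) \<in> U" "(g, h) \<in> V" using assms(6) by auto
  note c = subchar_carrier[OF assms(4) g(1)] subchar_carrier[OF assms(5) g(2)]
  have "bij_betw (\<lambda>k. g \<otimes>\<^bsub>G\<^esub> k) (Gamma_cap F G H U V) {g. (f, g) \<in> U \<and> (g, h) \<in> V}"
  proof (rule bij_betw_byWitness[where f' = "\<lambda>g'. inv\<^bsub>G\<^esub> g \<otimes>\<^bsub>G\<^esub> g'"])
    show "\<forall>k\<in>Gamma_cap F G H U V. inv\<^bsub>G\<^esub> g \<otimes>\<^bsub>G\<^esub> (g \<otimes>\<^bsub>G\<^esub> k) = k"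
      using c by (auto simp: Gamma_cap_def simp flip: G.m_assoc)
    show "\<forall>g'\<in>{g. (f, g) \<in> U \<and> (g, h) \<in> V}. g \<otimes>\<^bsub>G\<^esub> (inv\<^bsub>G\<^esub> g \<otimes>\<^bsub>G\<^esub> g') = g'"
      using c subchar_carrier[OF assms(4)] by (auto simp flip: G.m_assoc)
    show "(\<lambda>k. g \<otimes>\<^bsub>G\<^esub> k) ` Gamma_cap F G H U V \<subseteq> {g. (f, g) \<in> U \<and> (g, h) \<in> V}"
      using subchar_mult(1)[OF assms(4) g(1), of "\<one>\<^bsub>F\<^esub>"]
        subchar_mult(1)[OF assms(5) g(2), of _ "\<one>\<^bsub>H\<^esub>"] c
      by (auto simp: Gamma_cap_def)
    show "(\<lambda>g'. inv\<^bsub>G\<^esub> g \<otimes>\<^bsub>G\<^esub> g') ` {g. (f, g) \<in> U \<and> (g, h) \<in> V} \<subseteq> Gamma_cap F G H U V"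
      using middle_quotient[OF assms(1-5) g] by auto
  qed
  then show ?thesis by (simp add: bij_betw_same_card)
qed

end

section \<open>The linear category of subcharacters\<close>

context fibred_groups
begin

text \<open>Both bracketings of a triple product are governed by the same pairs \<open>(g, h)\<close>: those with
  \<open>(1, g) \<in> U\<close>, \<open>(g, h) \<in> V\<close>, \<open>(h, 1) \<in> W\<close>.  Their number is the product of the two orders
  \<open>|\<Gamma>\<^sub>\<inter>|\<close> that occur in each bracketing, and each bracketing is compatible precisely when
  \<open>\<mu>(1, g) \<nu>(g, h) \<omega>(h, 1) = 1\<close> for all of them.\<close>

definition triple_cap ::
  "'g monoid \<Rightarrow> 'g monoid \<Rightarrow> ('g \<times> 'g) set \<Rightarrow> ('g \<times> 'g) set \<Rightarrow> ('g \<times> 'g) set \<Rightarrow> ('g \<times> 'g) set"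
  where "triple_cap F I U V W = {(g, h). (\<one>\<^bsub>F\<^esub>, g) \<in> U \<and> (g, h) \<in> V \<and> (h, \<one>\<^bsub>I\<^esub>) \<in> W}"

context
  fixes F G H I :: "'g monoid" and U V W :: "('g \<times> 'g) set" and \<mu> \<nu> \<omega> :: "'g \<times> 'g \<Rightarrow> 'a"
  assumes obj: "F \<in> \<G>" "G \<in> \<G>" "H \<in> \<G>" "I \<in> \<G>"
    and u: "(U, \<mu>) \<in> Sub F G" and v: "(V, \<nu>) \<in> Sub G H" and w: "(W, \<omega>) \<in> Sub H I"
begin

definition triple_compat :: bool
  where "triple_compat \<longleftrightarrow> (\<forall>(g, h) \<in> triple_cap F I U V W.
    \<mu> (\<one>\<^bsub>F\<^esub>, g) \<otimes>\<^bsub>A\<^esub> \<nu> (g, h) \<otimes>\<^bsub>A\<^esub> \<omega> (h, \<one>\<^bsub>I\<^esub>) = \<one>\<^bsub>A\<^esub>)"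

lemma finite_triple_cap: "finite (triple_cap F I U V W)"
  by (rule finite_subset[OF _ finite_subchar[OF obj(2,3) v]]) (auto simp: triple_cap_def)

lemma card_triple_cap_left:
  "card (triple_cap F I U V W)
    = card (Gamma_cap F G H U V) * card (Gamma_cap F H I (U O V) W)"
proof -
  have im: "snd ` triple_cap F I U V W = Gamma_cap F H I (U O V) W"
    using subchar_carrier(2)[OF v] by (force simp: triple_cap_def Gamma_cap_def)
  have "card {x \<in> triple_cap F I U V W. snd x = h} = card (Gamma_cap F G H U V)"
    if "h \<in> snd ` triple_cap F I U V W" for h
  proof -
    have h: "(\<one>\<^bsub>F\<^esub>, h) \<in> U O V" "(h, \<one>\<^bsub>I\<^esub>) \<in> W" using that unfolding im by (auto simp: Gamma_cap_def)
    have "{x \<in> triple_cap F I U V W. snd x = h} = (\<lambda>g. (g, h)) ` {g. (\<one>\<^bsub>F\<^esub>, g) \<in> U \<and> (g, h) \<in> V}"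
      using h(2) by (auto simp: triple_cap_def)
    then show ?thesis using card_middle[OF obj(1-3) u v h(1)] by (simp add: card_image inj_on_def)
  qed
  from card_eq_card_image_times[OF finite_triple_cap this] show ?thesis by (simp add: im)
qed

lemma card_triple_cap_right:
  "card (triple_cap F I U V W)
    = card (Gamma_cap G H I V W) * card (Gamma_cap F G I U (V O W))"
proof -
  have im: "fst ` triple_cap F I U V W = Gamma_cap F G I U (V O W)"
    using subchar_carrier(1)[OF v] by (force simp: triple_cap_def Gamma_cap_def)
  have "card {x \<in> triple_cap F I U V W. fst x = g} = card (Gamma_cap G H I V W)"
    if "g \<in> fst ` triple_cap F I U V W" for g
  proof -
    have g: "(g, \<one>\<^bsub>I\<^esub>) \<in> V O W" "(\<one>\<^bsub>F\<^esub>, g) \<in> U" using that unfolding im by (auto simp: Gamma_cap_def)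
    have "{x \<in> triple_cap F I U V W. fst x = g} = (\<lambda>h. (g, h)) ` {h. (g, h) \<in> V \<and> (h, \<one>\<^bsub>I\<^esub>) \<in> W}"
      using g(2) by (auto simp: triple_cap_def)
    then show ?thesis using card_middle[OF obj(2-4) v w g(1)] by (simp add: card_image inj_on_def)
  qed
  from card_eq_card_image_times[OF finite_triple_cap this] show ?thesis by (simp add: im)
qed

text \<open>Taking \<open>h = 1\<close> in the triple condition recovers compatibility of \<open>u\<close> and \<open>v\<close>; once this is
  known, \<open>\<mu>(1, g) \<nu>(g, h)\<close> is the value of \<open>\<mu> * \<nu>\<close> at \<open>(1, h)\<close>.\<close>

lemma compat_iff_triple_left:
  "compat A F G H (U, \<mu>) (V, \<nu>) \<and> compat A F H I (star A (U, \<mu>) (V, \<nu>)) (W, \<omega>) \<longleftrightarrow> triple_compat"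
  (is "?c \<and> ?d \<longleftrightarrow> _")
proof -
  have "?d \<longleftrightarrow> triple_compat" if ?c
  proof -
    let ?s = "star A (U, \<mu>) (V, \<nu>)"
    have "?d \<longleftrightarrow> (\<forall>h\<in>Gamma_cap F H I (U O V) W. snd ?s (\<one>\<^bsub>F\<^esub>, h) \<otimes>\<^bsub>A\<^esub> \<omega> (h, \<one>\<^bsub>I\<^esub>) = \<one>\<^bsub>A\<^esub>)"
      by (simp add: compat_def star_def)
    also have "\<dots> \<longleftrightarrow> (\<forall>(g, h)\<in>triple_cap F I U V W.
        snd ?s (\<one>\<^bsub>F\<^esub>, h) \<otimes>\<^bsub>A\<^esub> \<omega> (h, \<one>\<^bsub>I\<^esub>) = \<one>\<^bsub>A\<^esub>)"
      using subchar_carrier(2)[OF v] by (fastforce simp: Gamma_cap_def triple_cap_def)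
    also have "\<dots> \<longleftrightarrow> triple_compat"
      unfolding triple_compat_def
      by (intro ball_cong refl) (auto simp: triple_cap_def snd_star[OF obj(1-3) u v that])
    finally show ?thesis .
  qed
  moreover have ?c if t: triple_compat
    unfolding compat_def
  proof clarsimp
    fix g assume "g \<in> Gamma_cap F G H U V"
    then have g: "(\<one>\<^bsub>F\<^esub>, g) \<in> U" "(g, \<one>\<^bsub>H\<^esub>) \<in> V" by (auto simp: Gamma_cap_def)
    then have "(g, \<one>\<^bsub>H\<^esub>) \<in> triple_cap F I U V W"
      using subchar_unit(1)[OF obj(3,4) w] by (auto simp: triple_cap_def)
    then show "\<mu> (\<one>\<^bsub>F\<^esub>, g) \<otimes>\<^bsub>A\<^esub> \<nu> (g, \<one>\<^bsub>H\<^esub>) = \<one>\<^bsub>A\<^esub>"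
      using t subchar_unit(2)[OF obj(3,4) w] subchar_value[OF u g(1)] subchar_value[OF v g(2)]
      by (auto simp: triple_compat_def)
  qed
  ultimately show ?thesis by blast
qed

lemma compat_iff_triple_right:
  "compat A G H I (V, \<nu>) (W, \<omega>) \<and> compat A F G I (U, \<mu>) (star A (V, \<nu>) (W, \<omega>)) \<longleftrightarrow> triple_compat"
  (is "?c \<and> ?d \<longleftrightarrow> _")
proof -
  have "?d \<longleftrightarrow> triple_compat" if ?c
  proof -
    let ?s = "star A (V, \<nu>) (W, \<omega>)"
    have "?d \<longleftrightarrow> (\<forall>g\<in>Gamma_cap F G I U (V O W). \<mu> (\<one>\<^bsub>F\<^esub>, g) \<otimes>\<^bsub>A\<^esub> snd ?s (g, \<one>\<^bsub>I\<^esub>) = \<one>\<^bsub>A\<^esub>)"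
      by (simp add: compat_def star_def)
    also have "\<dots> \<longleftrightarrow> (\<forall>(g, h)\<in>triple_cap F I U V W.
        \<mu> (\<one>\<^bsub>F\<^esub>, g) \<otimes>\<^bsub>A\<^esub> snd ?s (g, \<one>\<^bsub>I\<^esub>) = \<one>\<^bsub>A\<^esub>)"
      using subchar_carrier(1)[OF v] by (fastforce simp: Gamma_cap_def triple_cap_def)
    also have "\<dots> \<longleftrightarrow> triple_compat"
      unfolding triple_compat_def
      by (intro ball_cong refl) (auto simp: triple_cap_def snd_star[OF obj(2-4) v w that] A.m_assoc
          subchar_value[OF u] subchar_value[OF v] subchar_value[OF w])
    finally show ?thesis .
  qed
  moreover have ?c if t: triple_compat
    unfolding compat_def
  proof clarsimp
    fix h assume "h \<in> Gamma_cap G H I V W"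
    then have h: "(\<one>\<^bsub>G\<^esub>, h) \<in> V" "(h, \<one>\<^bsub>I\<^esub>) \<in> W" by (auto simp: Gamma_cap_def)
    then have "(\<one>\<^bsub>G\<^esub>, h) \<in> triple_cap F I U V W"
      using subchar_unit(1)[OF obj(1,2) u] by (auto simp: triple_cap_def)
    then show "\<nu> (\<one>\<^bsub>G\<^esub>, h) \<otimes>\<^bsub>A\<^esub> \<omega> (h, \<one>\<^bsub>I\<^esub>) = \<one>\<^bsub>A\<^esub>"
      using t subchar_unit(2)[OF obj(1,2) u] subchar_value[OF v h(1)]
      by (auto simp: triple_compat_def)
  qed
  ultimately show ?thesis by blast
qed

text \<open>Both sides take the value \<open>\<mu>(f, g) \<nu>(g, h) \<omega>(h, k)\<close> at \<open>(f, k)\<close> for any path \<open>f, g, h, k\<close>.\<close>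

lemma star_assoc:
  assumes triple_compat
  shows "star A (star A (U, \<mu>) (V, \<nu>)) (W, \<omega>) = star A (U, \<mu>) (star A (V, \<nu>) (W, \<omega>))"
    (is "?l = ?r")
proof -
  note L = assms[folded compat_iff_triple_left] and R = assms[folded compat_iff_triple_right]
  define \<rho> \<pi> where "\<rho> = snd (star A (U, \<mu>) (V, \<nu>))" and "\<pi> = snd (star A (V, \<nu>) (W, \<omega>))"
  have uv: "star A (U, \<mu>) (V, \<nu>) = (U O V, \<rho>)" and vw: "star A (V, \<nu>) (W, \<omega>) = (V O W, \<pi>)"
    by (simp_all add: \<rho>_def \<pi>_def prod_eq_iff)
  have s: "(U O V, \<rho>) \<in> Sub F H" "(V O W, \<pi>) \<in> Sub G I"
    using star_in[OF obj(1-3) u v] star_in[OF obj(2-4) v w] L R by (simp_all add: uv vw)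
  have "snd ?l (f, k) = snd ?r (f, k)" for f k
  proof (cases "(f, k) \<in> (U O V) O W")
    case True
    then obtain g h where p: "(f, g) \<in> U" "(g, h) \<in> V" "(h, k) \<in> W" by auto
    have "snd ?l (f, k) = \<mu> (f, g) \<otimes>\<^bsub>A\<^esub> \<nu> (g, h) \<otimes>\<^bsub>A\<^esub> \<omega> (h, k)"
      using snd_star[OF obj(1,3,4) s(1) w, of f h k] snd_star[OF obj(1-3) u v _ p(1,2)] L p
      by (auto simp: uv)
    moreover have "snd ?r (f, k) = \<mu> (f, g) \<otimes>\<^bsub>A\<^esub> (\<nu> (g, h) \<otimes>\<^bsub>A\<^esub> \<omega> (h, k))"
      using snd_star[OF obj(1,2,4) u s(2), of f g k] snd_star[OF obj(2-4) v w _ p(2,3)] R p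
      by (auto simp: vw)
    ultimately show ?thesis
      using subchar_value[OF u p(1)] subchar_value[OF v p(2)] subchar_value[OF w p(3)]
      by (simp add: A.m_assoc)
  next
    case False
    then show ?thesis by (auto simp: uv vw) (auto simp: star_def)
  qed
  then show ?thesis by (auto simp: prod_eq_iff uv vw fun_eq_iff O_assoc)
qed

lemma S_mult_assoc_basis:
  "bilinear_ext (S_mult l A F H I) (S_mult l A F G H (U, \<mu>) (V, \<nu>)) (basis (W, \<omega>))
    = bilinear_ext (S_mult l A F G I) (basis (U, \<mu>)) (S_mult l A G H I (V, \<nu>) (W, \<omega>))"
proof -
  let ?c = "\<lambda>F G H u v. compat A F G H u v" and ?s = "star A"
  have l: "?c F G H (U, \<mu>) (V, \<nu>) \<Longrightarrow> l (card (triple_cap F I U V W))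
      = l (card (Gamma_cap F G H U V)) * l (card (Gamma_cap F H I (U O V) W))"
    using l_mult[OF card_Gamma_cap_pos[OF obj(1-3) u v] card_Gamma_cap_pos[OF obj(1,3,4) _ w]]
      star_in[OF obj(1-3) u v] card_triple_cap_left
    by (metis fst_star prod.collapse)
  have r: "?c G H I (V, \<nu>) (W, \<omega>) \<Longrightarrow> l (card (triple_cap F I U V W))
      = l (card (Gamma_cap G H I V W)) * l (card (Gamma_cap F G I U (V O W)))"
    using l_mult[OF card_Gamma_cap_pos[OF obj(2-4) v w] card_Gamma_cap_pos[OF obj(1,2,4) u]]
      star_in[OF obj(2-4) v w] card_triple_cap_right
    by (metis fst_star prod.collapse)
  have "bilinear_ext (S_mult l A F H I) (S_mult l A F G H (U, \<mu>) (V, \<nu>)) (basis (W, \<omega>))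
      = (if triple_compat then fscale (l (card (triple_cap F I U V W)))
          (basis (?s (?s (U, \<mu>) (V, \<nu>)) (W, \<omega>))) else 0)"
    using l by (auto simp: S_mult_def bilinear_ext_simps compat_iff_triple_left[symmetric])
  moreover have "bilinear_ext (S_mult l A F G I) (basis (U, \<mu>)) (S_mult l A G H I (V, \<nu>) (W, \<omega>))
      = (if triple_compat then fscale (l (card (triple_cap F I U V W)))
          (basis (?s (U, \<mu>) (?s (V, \<nu>) (W, \<omega>)))) else 0)"
    using r by (auto simp: S_mult_def bilinear_ext_simps compat_iff_triple_right[symmetric])
  ultimately show ?thesis using star_assoc by simp
qed

end

abbreviation S_comp where "S_comp F G H \<equiv> bilinear_ext (S_mult l A F G H)"
abbreviation "S_mor F G \<equiv> (free_module (Sub F G) :: (('g \<times> 'g, 'a) subchar \<Rightarrow>\<^sub>0 'r) set)"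

lemma S_mult_in:
  assumes "F \<in> \<G>" "G \<in> \<G>" "H \<in> \<G>" "u \<in> Sub F G" "v \<in> Sub G H"
  shows "S_mult l A F G H u v \<in> S_mor F H"
  using star_in[OF assms] fscale.subspace_scale[OF subspace_free_module basis_in_free_module]
    fscale.subspace_0[OF subspace_free_module]
  by (auto simp: S_mult_def)

lemma S_comp_in:
  assumes "F \<in> \<G>" "G \<in> \<G>" "H \<in> \<G>" "x \<in> S_mor F G" "y \<in> S_mor G H"
  shows "S_comp F G H x y \<in> S_mor F H"
  using assms(4,5) S_mult_in[OF assms(1-3)] by (rule bilinear_ext_in_free_module)

lemma S_comp_assoc:
  assumes "F \<in> \<G>" "G \<in> \<G>" "H \<in> \<G>" "I \<in> \<G>"
    and "x \<in> S_mor F G" "y \<in> S_mor G H" "z \<in> S_mor H I"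
  shows "S_comp F H I (S_comp F G H x y) z = S_comp F G I x (S_comp G H I y z)"
  using assms(5)
proof (induction rule: free_module_induct)
  case (basis r u)
  from assms(6) show ?case
  proof (induction rule: free_module_induct)
    case (basis s v)
    from assms(7) show ?case
    proof (induction rule: free_module_induct)
      case (basis t w)
      obtain U \<mu> V \<nu> W \<omega> where "u = (U, \<mu>)" "v = (V, \<nu>)" "w = (W, \<omega>)" by (metis surj_pair)
      then show ?case
        using S_mult_assoc_basis[OF assms(1-4), of U \<mu> V \<nu> W \<omega>] basis
          \<open>u \<in> Sub F G\<close> \<open>v \<in> Sub G H\<close> by (simp add: bilinear_ext_simps mult.assoc)
    qed (simp_all add: bilinear_ext_simps)
  qed (simp_all add: bilinear_ext_simps)
qed (simp_all add: bilinear_ext_simps)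

end

section \<open>Conjugation and the invariant category\<close>

context fibred_groups
begin

lemma twisted_diagonal_mem:
  "(a, b) \<in> fst (twisted_diagonal A G g) \<longleftrightarrow> b \<in> carrier G \<and> a = g \<otimes>\<^bsub>G\<^esub> b \<otimes>\<^bsub>G\<^esub> inv\<^bsub>G\<^esub> g"
  by (auto simp: twisted_diagonal_def Let_def)

lemma twisted_diagonal_value:
  "x \<in> fst (twisted_diagonal A G g) \<Longrightarrow> snd (twisted_diagonal A G g) x = \<one>\<^bsub>A\<^esub>"
  by (auto simp: twisted_diagonal_def Let_def)

lemma twisted_diagonal_in:
  assumes "G \<in> \<G>" "g \<in> carrier G"
  shows "twisted_diagonal A G g \<in> Sub G G"
proof -
  interpret G: group G by (rule group_obj[OF assms(1)])
  interpret GG: group "G \<times>\<times> G" using assms by (intro group_prod)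
  obtain D \<delta> where D: "twisted_diagonal A G g = (D, \<delta>)" by (cases "twisted_diagonal A G g")
  have mem: "(a, b) \<in> D \<longleftrightarrow> b \<in> carrier G \<and> a = g \<otimes>\<^bsub>G\<^esub> b \<otimes>\<^bsub>G\<^esub> inv\<^bsub>G\<^esub> g" for a b
    using twisted_diagonal_mem[of a b G g] by (simp add: D)
  have val: "x \<in> D \<Longrightarrow> \<delta> x = \<one>\<^bsub>A\<^esub>" for x
    using twisted_diagonal_value[of x G g] by (simp add: D)
  have m: "g \<otimes>\<^bsub>G\<^esub> a \<otimes>\<^bsub>G\<^esub> inv\<^bsub>G\<^esub> g \<otimes>\<^bsub>G\<^esub> (g \<otimes>\<^bsub>G\<^esub> b \<otimes>\<^bsub>G\<^esub> inv\<^bsub>G\<^esub> g) = g \<otimes>\<^bsub>G\<^esub> (a \<otimes>\<^bsub>G\<^esub> b) \<otimes>\<^bsub>G\<^esub> inv\<^bsub>G\<^esub> g"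
    if "a \<in> carrier G" "b \<in> carrier G" for a b
    using that assms(2) by (simp add: G.m_assoc) (simp flip: G.m_assoc)
  have mc: "x \<otimes>\<^bsub>G \<times>\<times> G\<^esub> y \<in> D" if "x \<in> D" "y \<in> D" for x y
    using that by (cases x; cases y) (auto simp: mem m)
  show ?thesis unfolding D
  proof (rule subcharsI)
    show "subgroup D (G \<times>\<times> G)"
    proof (rule GG.subgroupI)
      show "D \<subseteq> carrier (G \<times>\<times> G)" using assms(2) by (auto simp: mem)
      show "D \<noteq> {}" using mem G.one_closed by blast
      show "inv\<^bsub>G \<times>\<times> G\<^esub> x \<in> D" if "x \<in> D" for x
        using that assms(2) G.is_group by (cases x) (auto simp: mem G.inv_mult_group G.m_assoc)
    qed (rule mc)
    show "\<delta> \<in> extensional D" using D by (auto simp: twisted_diagonal_def Let_def)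
  qed (simp_all add: val mc)
qed

lemma diagonal_eq:
  assumes "G \<in> \<G>"
  shows "diagonal A G = twisted_diagonal A G \<one>\<^bsub>G\<^esub>"
proof -
  interpret G: group G by (rule group_obj[OF assms])
  have "{(y, y) |y. y \<in> carrier G} = {(\<one>\<^bsub>G\<^esub> \<otimes>\<^bsub>G\<^esub> y \<otimes>\<^bsub>G\<^esub> inv\<^bsub>G\<^esub> \<one>\<^bsub>G\<^esub>, y) |y. y \<in> carrier G}" by force
  then show ?thesis by (simp add: diagonal_def twisted_diagonal_def)
qed

lemma conj_subchar_pair:
  assumes "F \<in> \<G>" "G \<in> \<G>" "f \<in> carrier F" "g \<in> carrier G" "(U, \<mu>) \<in> Sub F G"
  shows "conj_subchar (F \<times>\<times> G) (f, g) (U, \<mu>)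
    = (let c = (\<lambda>(a, b). (inv\<^bsub>F\<^esub> f \<otimes>\<^bsub>F\<^esub> a \<otimes>\<^bsub>F\<^esub> f, inv\<^bsub>G\<^esub> g \<otimes>\<^bsub>G\<^esub> b \<otimes>\<^bsub>G\<^esub> g));
           U' = {x \<in> carrier F \<times> carrier G. c x \<in> U}
       in (U', restrict (\<lambda>x. \<mu> (c x)) U'))"
  using assms subgroup.subset[OF subcharsD(1)[OF assms(5)]] group_obj group_prod
  by (subst conj_subchar_eq) (auto simp: Let_def restrict_def fun_eq_iff)

text \<open>A twisted diagonal is the graph of an automorphism, so \<open>\<Gamma>\<^sub>\<inter> = 1\<close>: a product with it is always
  compatible, has coefficient \<open>\<ell>(1) = 1\<close>, and amounts to a conjugation.\<close>

lemma S_mult_twisted_left: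
  assumes "F \<in> \<G>" "G \<in> \<G>" "f \<in> carrier F" "u \<in> Sub F G"
  shows "S_mult l A F F G (twisted_diagonal A F f) u
    = basis (conj_subchar (F \<times>\<times> G) (f, \<one>\<^bsub>G\<^esub>) u)"
proof -
  interpret F: group F by (rule group_obj[OF assms(1)])
  interpret G: group G by (rule group_obj[OF assms(2)])
  obtain D \<delta> where D: "twisted_diagonal A F f = (D, \<delta>)" by (cases "twisted_diagonal A F f")
  have mem: "(a, b) \<in> D \<longleftrightarrow> b \<in> carrier F \<and> a = f \<otimes>\<^bsub>F\<^esub> b \<otimes>\<^bsub>F\<^esub> inv\<^bsub>F\<^esub> f" for a b
    using twisted_diagonal_mem[of a b F f] by (simp add: D)
  have val: "x \<in> D \<Longrightarrow> \<delta> x = \<one>\<^bsub>A\<^esub>" for x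
    using twisted_diagonal_value[of x F f] by (simp add: D)
  obtain U \<mu> where u: "u = (U, \<mu>)" by (cases u)
  note uS = assms(4)[unfolded u]
  have DS: "(D, \<delta>) \<in> Sub F F" using twisted_diagonal_in[OF assms(1,3)] by (simp add: D)
  have \<Gamma>: "Gamma_cap F F G D U = {\<one>\<^bsub>F\<^esub>}"
  proof -
    have "b = \<one>\<^bsub>F\<^esub>" if "(\<one>\<^bsub>F\<^esub>, b) \<in> D" for b
    proof -
      have "b \<in> carrier F" "f \<otimes>\<^bsub>F\<^esub> b \<otimes>\<^bsub>F\<^esub> inv\<^bsub>F\<^esub> f = \<one>\<^bsub>F\<^esub>" using that mem by auto
      then show ?thesis using assms(3)
        by (metis F.inv_closed F.inv_inv F.inv_equality F.l_cancel_one' F.m_closed)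
    qed
    then show ?thesis using subchar_unit(1)[OF assms(1,1) DS] subchar_unit(1)[OF assms(1,2) uS]
      by (auto simp: Gamma_cap_def)
  qed
  have c: "compat A F F G (D, \<delta>) (U, \<mu>)"
    using subchar_unit[OF assms(1,1) DS] subchar_unit[OF assms(1,2) uS] by (auto simp: compat_def \<Gamma>)
  let ?k = "\<lambda>a. inv\<^bsub>F\<^esub> f \<otimes>\<^bsub>F\<^esub> a \<otimes>\<^bsub>F\<^esub> f"
  have Dk: "(a, ?k a) \<in> D" if "a \<in> carrier F" for a
    using that assms(3) by (simp add: mem F.m_assoc) (simp flip: F.m_assoc)
  have kD: "?k a = y" if "(a, y) \<in> D" for a y
    using that assms(3) by (simp add: mem F.m_assoc) (simp flip: F.m_assoc)
  define s where "s = snd (star A (D, \<delta>) (U, \<mu>))"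
  have star: "star A (D, \<delta>) (U, \<mu>) = (D O U, s)" by (simp add: s_def prod_eq_iff)
  have set: "D O U = {(a, b). a \<in> carrier F \<and> b \<in> carrier G \<and> (?k a, b) \<in> U}"
    using kD Dk subchar_carrier[OF DS] subchar_carrier[OF uS] by auto
  have "s (a, b) = \<mu> (?k a, b)" if "(a, b) \<in> D O U" for a b
    using snd_star[OF assms(1,1,2) DS uS c, of a "?k a" b] that Dk[of a] subchar_value[OF uS]
    by (simp add: s_def set val)
  moreover have "s x = undefined" if "x \<notin> D O U" for x
    using that by (auto simp: s_def star_def)
  ultimately have "(D O U, s) = conj_subchar (F \<times>\<times> G) (f, \<one>\<^bsub>G\<^esub>) (U, \<mu>)"
    using assms(3) unfolding conj_subchar_pair[OF assms(1-3) G.one_closed uS] Let_def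
    by (auto simp: set fun_eq_iff restrict_def)
  then show ?thesis using c l_one by (simp add: S_mult_def D u \<Gamma> star)
qed

lemma S_mult_twisted_right:
  assumes "F \<in> \<G>" "G \<in> \<G>" "g \<in> carrier G" "u \<in> Sub F G"
  shows "S_mult l A F G G u (twisted_diagonal A G g)
    = basis (conj_subchar (F \<times>\<times> G) (\<one>\<^bsub>F\<^esub>, inv\<^bsub>G\<^esub> g) u)"
proof -
  interpret F: group F by (rule group_obj[OF assms(1)])
  interpret G: group G by (rule group_obj[OF assms(2)])
  obtain D \<delta> where D: "twisted_diagonal A G g = (D, \<delta>)" by (cases "twisted_diagonal A G g")
  have mem: "(a, b) \<in> D \<longleftrightarrow> b \<in> carrier G \<and> a = g \<otimes>\<^bsub>G\<^esub> b \<otimes>\<^bsub>G\<^esub> inv\<^bsub>G\<^esub> g" for a b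
    using twisted_diagonal_mem[of a b G g] by (simp add: D)
  have val: "x \<in> D \<Longrightarrow> \<delta> x = \<one>\<^bsub>A\<^esub>" for x
    using twisted_diagonal_value[of x G g] by (simp add: D)
  obtain U \<mu> where u: "u = (U, \<mu>)" by (cases u)
  note uS = assms(4)[unfolded u]
  have DS: "(D, \<delta>) \<in> Sub G G" using twisted_diagonal_in[OF assms(2,3)] by (simp add: D)
  have \<Gamma>: "Gamma_cap F G G U D = {\<one>\<^bsub>G\<^esub>}"
    using subchar_unit(1)[OF assms(2,2) DS] subchar_unit(1)[OF assms(1,2) uS] assms(3)
    by (auto simp: Gamma_cap_def mem)
  have c: "compat A F G G (U, \<mu>) (D, \<delta>)"
    using subchar_unit[OF assms(2,2) DS] subchar_unit[OF assms(1,2) uS] by (auto simp: compat_def \<Gamma>)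
  let ?k = "\<lambda>b. g \<otimes>\<^bsub>G\<^esub> b \<otimes>\<^bsub>G\<^esub> inv\<^bsub>G\<^esub> g"
  have Dk: "(?k b, b) \<in> D" if "b \<in> carrier G" for b
    using that by (simp add: mem)
  define s where "s = snd (star A (U, \<mu>) (D, \<delta>))"
  have star: "star A (U, \<mu>) (D, \<delta>) = (U O D, s)" by (simp add: s_def prod_eq_iff)
  have set: "U O D = {(a, b). a \<in> carrier F \<and> b \<in> carrier G \<and> (a, ?k b) \<in> U}"
    using Dk subchar_carrier[OF uS] by (auto simp: mem)
  have "s (a, b) = \<mu> (a, ?k b)" if "(a, b) \<in> U O D" for a b
    using snd_star[OF assms(1,2,2) uS DS c, of a "?k b" b] that Dk[of b] subchar_value[OF uS]
    by (simp add: s_def set val)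
  moreover have "s x = undefined" if "x \<notin> U O D" for x
    using that by (auto simp: s_def star_def)
  ultimately have "(U O D, s) = conj_subchar (F \<times>\<times> G) (\<one>\<^bsub>F\<^esub>, inv\<^bsub>G\<^esub> g) (U, \<mu>)"
    using assms(3)
    unfolding conj_subchar_pair[OF assms(1,2) F.one_closed G.inv_closed[OF assms(3)] uS] Let_def
    by (auto simp: set fun_eq_iff restrict_def)
  then show ?thesis using c l_one by (simp add: S_mult_def D u \<Gamma> star)
qed

abbreviation tw :: "'g monoid \<Rightarrow> 'g \<Rightarrow> (('g \<times> 'g, 'a) subchar \<Rightarrow>\<^sub>0 'r)"
  where "tw G g \<equiv> basis (twisted_diagonal A G g)"

lemma tw_in: "G \<in> \<G> \<Longrightarrow> g \<in> carrier G \<Longrightarrow> tw G g \<in> S_mor G G"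
  by (intro basis_in_free_module twisted_diagonal_in)

lemma tw_basis_tw:
  assumes "F \<in> \<G>" "G \<in> \<G>" "f \<in> carrier F" "g \<in> carrier G" "u \<in> Sub F G"
  shows "S_comp F G G (S_comp F F G (tw F f) (basis u)) (tw G g)
    = basis (conj_subchar (F \<times>\<times> G) (f, inv\<^bsub>G\<^esub> g) u)"
proof -
  interpret F: group F by (rule group_obj[OF assms(1)])
  interpret G: group G by (rule group_obj[OF assms(2)])
  note c = conj_subchar_in[OF group_prod[OF assms(1,2)] _ assms(5)]
  show ?thesis using assms
    by (simp add: S_mult_twisted_left S_mult_twisted_right c
        conj_subchar_mult[OF group_prod[OF assms(1,2)] _ _ assms(5)])
qed

lemma tw_one_left:
  assumes "F \<in> \<G>" "G \<in> \<G>" "x \<in> S_mor F G"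
  shows "S_comp F F G (tw F \<one>\<^bsub>F\<^esub>) x = x"
  using assms(3)
proof (induction rule: free_module_induct)
  case (basis r u)
  then show ?case
    using assms(1,2) conj_subchar_one[OF group_prod[OF assms(1,2)] basis]
      group_obj[OF assms(1)] by (simp add: bilinear_ext_simps S_mult_twisted_left group.is_monoid)
qed (simp_all add: bilinear_ext_simps)

lemma tw_one_right:
  assumes "F \<in> \<G>" "G \<in> \<G>" "x \<in> S_mor F G"
  shows "S_comp F G G x (tw G \<one>\<^bsub>G\<^esub>) = x"
  using assms(3)
proof (induction rule: free_module_induct)
  case (basis r u)
  interpret G: group G by (rule group_obj[OF assms(2)])
  show ?case
    using assms(1,2) conj_subchar_one[OF group_prod[OF assms(1,2)] basis] basis
    by (simp add: bilinear_ext_simps S_mult_twisted_right)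
qed (simp_all add: bilinear_ext_simps)

lemma conj_twisted_diagonal_left:
  assumes "G \<in> \<G>" "g \<in> carrier G" "h \<in> carrier G"
  shows "conj_subchar (G \<times>\<times> G) (g, \<one>\<^bsub>G\<^esub>) (twisted_diagonal A G h) = twisted_diagonal A G (g \<otimes>\<^bsub>G\<^esub> h)"
proof -
  interpret G: group G by (rule group_obj[OF assms(1)])
  have "(\<lambda>t. (g, \<one>\<^bsub>G\<^esub>) \<otimes>\<^bsub>G \<times>\<times> G\<^esub> t \<otimes>\<^bsub>G \<times>\<times> G\<^esub> inv\<^bsub>G \<times>\<times> G\<^esub> (g, \<one>\<^bsub>G\<^esub>)) `
      {(h \<otimes>\<^bsub>G\<^esub> y \<otimes>\<^bsub>G\<^esub> inv\<^bsub>G\<^esub> h, y) |y. y \<in> carrier G}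
    = {(g \<otimes>\<^bsub>G\<^esub> h \<otimes>\<^bsub>G\<^esub> y \<otimes>\<^bsub>G\<^esub> inv\<^bsub>G\<^esub> (g \<otimes>\<^bsub>G\<^esub> h), y) |y. y \<in> carrier G}" (is "?c ` ?D = ?E")
  proof -
    have "?c (h \<otimes>\<^bsub>G\<^esub> y \<otimes>\<^bsub>G\<^esub> inv\<^bsub>G\<^esub> h, y) = (g \<otimes>\<^bsub>G\<^esub> h \<otimes>\<^bsub>G\<^esub> y \<otimes>\<^bsub>G\<^esub> inv\<^bsub>G\<^esub> (g \<otimes>\<^bsub>G\<^esub> h), y)"
      if "y \<in> carrier G" for y
      using that assms by (simp add: G.m_assoc G.inv_mult_group G.is_group)
    then show ?thesis by (force simp: image_iff)
  qed
  moreover have "inv\<^bsub>G \<times>\<times> G\<^esub> (g, \<one>\<^bsub>G\<^esub>) \<otimes>\<^bsub>G \<times>\<times> G\<^esub> x \<otimes>\<^bsub>G \<times>\<times> G\<^esub> (g, \<one>\<^bsub>G\<^esub>)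
      \<in> {(h \<otimes>\<^bsub>G\<^esub> y \<otimes>\<^bsub>G\<^esub> inv\<^bsub>G\<^esub> h, y) |y. y \<in> carrier G}"
    if "x \<in> {(g \<otimes>\<^bsub>G\<^esub> h \<otimes>\<^bsub>G\<^esub> y \<otimes>\<^bsub>G\<^esub> inv\<^bsub>G\<^esub> (g \<otimes>\<^bsub>G\<^esub> h), y) |y. y \<in> carrier G}" for x
    using that assms
    by (auto simp: G.m_assoc G.inv_mult_group G.is_group) (simp flip: G.m_assoc)
  ultimately show ?thesis
    unfolding conj_subchar_def twisted_diagonal_def Let_def split_conv
    by (auto simp: fun_eq_iff restrict_def)
qed

lemma tw_tw:
  assumes "G \<in> \<G>" "g \<in> carrier G" "h \<in> carrier G"
  shows "S_comp G G G (tw G g) (tw G h) = tw G (g \<otimes>\<^bsub>G\<^esub> h)"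
  using assms by (simp add: S_mult_twisted_left twisted_diagonal_in conj_twisted_diagonal_left)

abbreviation idem :: "'g monoid \<Rightarrow> (('g \<times> 'g, 'a) subchar \<Rightarrow>\<^sub>0 'r)"
  where "idem G \<equiv> \<sigma> A G (trivial_idem G)"

lemma idem_eq: "idem G = fscale (inv_of_nat (card (carrier G))) (\<Sum>g\<in>carrier G. tw G g)"
  by (simp add: \<sigma>_def trivial_idem_def linear_ext_scale linear_ext_sum)

lemma idem_in: "G \<in> \<G> \<Longrightarrow> idem G \<in> S_mor G G"
  unfolding idem_eq
  by (intro fscale.subspace_scale[OF subspace_free_module] fscale.subspace_sum[OF subspace_free_module] tw_in)

lemma tw_idem:
  assumes "G \<in> \<G>" "g \<in> carrier G"
  shows "S_comp G G G (tw G g) (idem G) = idem G"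
proof -
  interpret G: group G by (rule group_obj[OF assms(1)])
  have "S_comp G G G (tw G g) (\<Sum>h\<in>carrier G. tw G h) = (\<Sum>h\<in>carrier G. tw G (g \<otimes>\<^bsub>G\<^esub> h))"
    using assms by (simp add: module_hom.sum[OF bilinear_ext_right] tw_tw del: bilinear_ext_basis)
  also have "\<dots> = (\<Sum>h\<in>carrier G. tw G h)"
    by (rule sum.reindex_bij_witness[where i = "\<lambda>h. inv\<^bsub>G\<^esub> g \<otimes>\<^bsub>G\<^esub> h" and j = "\<lambda>h. g \<otimes>\<^bsub>G\<^esub> h"])
      (use assms(2) in \<open>auto simp flip: G.m_assoc\<close>)
  finally show ?thesis by (simp add: idem_eq bilinear_ext_simps)
qed

lemma idem_tw:
  assumes "G \<in> \<G>" "g \<in> carrier G"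
  shows "S_comp G G G (idem G) (tw G g) = idem G"
proof -
  interpret G: group G by (rule group_obj[OF assms(1)])
  have "S_comp G G G (\<Sum>h\<in>carrier G. tw G h) (tw G g) = (\<Sum>h\<in>carrier G. tw G (h \<otimes>\<^bsub>G\<^esub> g))"
    using assms by (simp add: module_hom.sum[OF bilinear_ext_left] tw_tw del: bilinear_ext_basis)
  also have "\<dots> = (\<Sum>h\<in>carrier G. tw G h)"
    by (rule sum.reindex_bij_witness[where i = "\<lambda>h. h \<otimes>\<^bsub>G\<^esub> inv\<^bsub>G\<^esub> g" and j = "\<lambda>h. h \<otimes>\<^bsub>G\<^esub> g"])
      (use assms(2) in \<open>auto simp: G.m_assoc\<close>)
  finally show ?thesis by (simp add: idem_eq bilinear_ext_simps)
qed

text \<open>Invariance under \<open>F \<times> G\<close> amounts to invariance under multiplication on either side separately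
  (\<open>Mor_inv_S_cat\<close>).  In this form it is visibly inherited by products, and it gives
  \<open>e\<^sub>F x = x = x e\<^sub>G\<close>.\<close>

definition inv_mor :: "'g monoid \<Rightarrow> 'g monoid \<Rightarrow> (('g \<times> 'g, 'a) subchar \<Rightarrow>\<^sub>0 'r) set"
  where "inv_mor F G = {x \<in> S_mor F G.
    (\<forall>f\<in>carrier F. S_comp F F G (tw F f) x = x) \<and> (\<forall>g\<in>carrier G. S_comp F G G x (tw G g) = x)}"

lemma Mor_inv_S_cat:
  assumes "F \<in> \<G>" "G \<in> \<G>"
  shows "Mor (inv_S_cat l A \<G>) F G = inv_mor F G"
proof -
  interpret F: group F by (rule group_obj[OF assms(1)])
  interpret G: group G by (rule group_obj[OF assms(2)])
  have act: "S_action l A \<G> F G (f, g) x = S_comp F G G (S_comp F F G (tw F f) x) (tw G (inv\<^bsub>G\<^esub> g))"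
    for f g x
    by (simp add: S_action_def S_cat_def \<sigma>_def)
  have "(\<forall>z\<in>carrier (F \<times>\<times> G). S_action l A \<G> F G z x = x) \<longleftrightarrow>
      (\<forall>f\<in>carrier F. S_comp F F G (tw F f) x = x) \<and> (\<forall>g\<in>carrier G. S_comp F G G x (tw G g) = x)"
    (is "?a \<longleftrightarrow> ?l \<and> ?r") if x: "x \<in> S_mor F G" for x
  proof (intro iffI conjI ballI)
    fix f assume a: ?a and f: "f \<in> carrier F"
    have "S_action l A \<G> F G (f, \<one>\<^bsub>G\<^esub>) x = x" using a f by simp
    then show "S_comp F F G (tw F f) x = x"
      using tw_one_right[OF assms S_comp_in[OF assms(1,1,2) tw_in[OF assms(1) f] x]]
      by (simp add: act)
  next
    fix g assume a: ?a and g: "g \<in> carrier G"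
    then have "S_action l A \<G> F G (\<one>\<^bsub>F\<^esub>, inv\<^bsub>G\<^esub> g) x = x" by simp
    then show "S_comp F G G x (tw G g) = x" using g by (simp add: act tw_one_left[OF assms x])
  next
    fix z assume "?l \<and> ?r" "z \<in> carrier (F \<times>\<times> G)"
    then show "S_action l A \<G> F G z x = x" by (auto simp: act)
  qed
  moreover have "Mor (inv_S_cat l A \<G>) F G
      = {x \<in> S_mor F G. \<forall>z\<in>carrier (F \<times>\<times> G). S_action l A \<G> F G z x = x}"
    by (simp add: inv_S_cat_def) (simp add: S_cat_def)
  ultimately show ?thesis unfolding inv_mor_def by blast
qed

lemma subspace_inv_mor: "fscale.subspace (inv_mor F G)"
  by (rule fscale.subspaceI)
    (auto simp: inv_mor_def bilinear_ext_simps fscale.subspace_0[OF subspace_free_module]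
      fscale.subspace_add[OF subspace_free_module] fscale.subspace_scale[OF subspace_free_module])

lemma inv_mor_comp:
  assumes "F \<in> \<G>" "G \<in> \<G>" "H \<in> \<G>" "x \<in> inv_mor F G" "y \<in> inv_mor G H"
  shows "S_comp F G H x y \<in> inv_mor F H"
  using assms S_comp_in[OF assms(1-3)]
  by (auto simp: inv_mor_def S_comp_assoc[OF assms(1,1,2,3) tw_in, symmetric]
      S_comp_assoc[OF assms(1,2,3,3) _ _ tw_in])

lemma idem_inv: "G \<in> \<G> \<Longrightarrow> idem G \<in> inv_mor G G"
  by (simp add: inv_mor_def idem_in tw_idem idem_tw)

end

locale rational_fibred_groups = fibred_groups \<G> A l
  for \<G> :: "'g monoid set" and A :: "'a monoid" and l :: "nat \<Rightarrow> 'r::comm_ring_1" +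
  assumes of_nat_unit: "n > 0 \<Longrightarrow> (of_nat n :: 'r) dvd 1"
begin

lemma card_obj_pos: "G \<in> \<G> \<Longrightarrow> card (carrier G) > 0"
  using finite_obj group_obj[THEN group.is_monoid, THEN monoid.one_closed]
  by (auto simp: card_gt_0_iff)

lemma of_nat_inverse [simp]:
  assumes "n > 0"
  shows "of_nat n * inv_of_nat n = (1 :: 'r)" "inv_of_nat n * of_nat n = (1 :: 'r)"
  using of_nat_inv_of_nat[OF of_nat_unit[OF assms]] by (simp_all add: mult.commute)

lemma idem_left:
  assumes "F \<in> \<G>" "\<And>f. f \<in> carrier F \<Longrightarrow> S_comp F F G (tw F f) x = x"
  shows "S_comp F F G (idem F) x = x"
  using assms card_obj_pos[OF assms(1)]
  by (simp add: idem_eq bilinear_ext_simps module_hom.sum[OF bilinear_ext_left]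
      fscale.sum_constant_scale)

end

context rational_fibred_groups
begin

lemma idem_right:
  assumes "G \<in> \<G>" "\<And>g. g \<in> carrier G \<Longrightarrow> S_comp F G G x (tw G g) = x"
  shows "S_comp F G G x (idem G) = x"
  using assms card_obj_pos[OF assms(1)]
  by (simp add: idem_eq bilinear_ext_simps module_hom.sum[OF bilinear_ext_right]
      fscale.sum_constant_scale)

lemma linear_category_inv_S_cat: "linear_category (inv_S_cat l A \<G>)"
proof -
  have C: "Obj (inv_S_cat l A \<G>) = \<G>" "Scl (inv_S_cat l A \<G>) = fscale"
    "Comp (inv_S_cat l A \<G>) = S_comp" "Ident (inv_S_cat l A \<G>) = idem"
    by (simp_all add: inv_S_cat_def S_cat_def)
  have S: "x \<in> S_mor F G" if "x \<in> inv_mor F G" for x F G using that by (simp add: inv_mor_def)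
  show ?thesis
    by (intro linear_category.intro linear_category_axioms.intro)
      (simp_all add: C Mor_inv_S_cat module_fscale subspace_inv_mor inv_mor_comp idem_inv
        bilinear_ext_simps S_comp_assoc[OF _ _ _ _ S S S],
        auto simp: inv_mor_def idem_left idem_right)
qed

text \<open>Symmetrisation, a projection onto the invariants.  On the basis vector of \<open>u\<close> it is the element
  \<open>s_bar\<close>, which is thereby extended to a linear map.\<close>

definition avg :: "'g monoid \<Rightarrow> 'g monoid \<Rightarrow> (('g \<times> 'g, 'a) subchar \<Rightarrow>\<^sub>0 'r)
    \<Rightarrow> (('g \<times> 'g, 'a) subchar \<Rightarrow>\<^sub>0 'r)"
  where "avg F G x = S_comp F G G (S_comp F F G (idem F) x) (idem G)"

lemma s_bar_eq: "s_bar l A \<G> F G u = avg F G (basis u)"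
  by (simp add: s_bar_def avg_def S_cat_def)

lemma avg_linear [simp]: "avg F G 0 = 0" "avg F G (x + y) = avg F G x + avg F G y"
    "avg F G (fscale r x) = fscale r (avg F G x)"
  by (simp_all add: avg_def bilinear_ext_simps)

lemma avg_in:
  assumes "F \<in> \<G>" "G \<in> \<G>" "x \<in> S_mor F G"
  shows "avg F G x \<in> inv_mor F G"
proof -
  let ?ex = "S_comp F F G (idem F) x"
  have ex: "?ex \<in> S_mor F G" using assms by (intro S_comp_in idem_in)
  have "S_comp F F G (tw F f) ?ex = ?ex" if "f \<in> carrier F" for f
    using assms that S_comp_assoc[OF assms(1,1,1,2) tw_in[OF assms(1) that] idem_in[OF assms(1)] assms(3)]
    by (simp add: tw_idem)
  then show ?thesis
    using assms ex S_comp_in[OF assms(1,2,2) ex idem_in[OF assms(2)]]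
      S_comp_assoc[OF assms(1,1,2,2) tw_in[OF assms(1)] ex idem_in[OF assms(2)]]
      S_comp_assoc[OF assms(1,2,2,2) ex idem_in[OF assms(2)] tw_in[OF assms(2)]]
    by (simp add: inv_mor_def avg_def idem_tw)
qed

lemma avg_inv: "F \<in> \<G> \<Longrightarrow> G \<in> \<G> \<Longrightarrow> x \<in> inv_mor F G \<Longrightarrow> avg F G x = x"
  by (simp add: avg_def inv_mor_def idem_left idem_right)

lemma s_bar_conj:
  assumes "F \<in> \<G>" "G \<in> \<G>" "e \<in> carrier (F \<times>\<times> G)" "u \<in> Sub F G"
  shows "s_bar l A \<G> F G (conj_subchar (F \<times>\<times> G) e u) = s_bar l A \<G> F G u"
proof -
  interpret G: group G by (rule group_obj[OF assms(2)])
  obtain f g where e: "e = (f, g)" "f \<in> carrier F" "g \<in> carrier G" using assms(3) by auto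
  let ?u = "basis u :: (('g \<times> 'g, 'a) subchar \<Rightarrow>\<^sub>0 'r)"
  have u: "?u \<in> S_mor F G" using assms(4) by (rule basis_in_free_module)
  note f = tw_in[OF assms(1) e(2)] and g = tw_in[OF assms(2) G.inv_closed[OF e(3)]]
    and eF = idem_in[OF assms(1)] and eG = idem_in[OF assms(2)]
  have fu: "S_comp F F G (tw F f) ?u \<in> S_mor F G" using assms f u by (intro S_comp_in)
  have eu: "S_comp F F G (idem F) ?u \<in> S_mor F G" using assms eF u by (intro S_comp_in)
  have "S_comp F F G (idem F) (S_comp F G G (S_comp F F G (tw F f) ?u) (tw G (inv\<^bsub>G\<^esub> g)))
      = S_comp F G G (S_comp F F G (idem F) (S_comp F F G (tw F f) ?u)) (tw G (inv\<^bsub>G\<^esub> g))"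
    by (rule S_comp_assoc[OF assms(1,1,2,2) eF fu g, symmetric])
  also have "S_comp F F G (idem F) (S_comp F F G (tw F f) ?u) = S_comp F F G (idem F) ?u"
    using S_comp_assoc[OF assms(1,1,1,2) eF f u] by (simp add: idem_tw assms e)
  finally show ?thesis
    using S_comp_assoc[OF assms(1,2,2,2) eu g eG] tw_basis_tw[OF assms(1,2) e(2) _ assms(4), of "inv\<^bsub>G\<^esub> g"]
    by (simp add: s_bar_eq avg_def e tw_idem assms del: bilinear_ext_basis)
qed


section \<open>The isomorphism and its inverse\<close>

text \<open>The defining formula \<open>|G| s_bar \<leftrightarrow> |U| [u]\<close> and invariance under conjugation leave no choice for
  the coefficient.  Using all morphisms as the domain, instead of the invariant ones,
  permits proofs on the basis vectors of \<open>u\<close>, which in general are not invariant.\<close>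

definition Phi :: "'g monoid \<Rightarrow> 'g monoid \<Rightarrow> (('g \<times> 'g, 'a) subchar \<Rightarrow>\<^sub>0 'r)
    \<Rightarrow> (('g \<times> 'g, 'a) subchar set \<Rightarrow>\<^sub>0 'r)"
  where "Phi F G = linear_ext (\<lambda>u. fscale (of_nat (card (fst u)) * inv_of_nat (card (carrier G)))
    (basis (subchar_class (F \<times>\<times> G) u)))"

lemma Phi_linear [simp]: "Phi F G 0 = 0" "Phi F G (x + y) = Phi F G x + Phi F G y"
    "Phi F G (fscale r x) = fscale r (Phi F G x)"
    "Phi F G (\<Sum>i\<in>J. h i) = (\<Sum>i\<in>J. Phi F G (h i))"
  by (simp_all add: Phi_def linear_ext_zero linear_ext_add linear_ext_scale linear_ext_sum)

lemma Phi_basis: "Phi F G (basis u) = fscale (of_nat (card (fst u)) * inv_of_nat (card (carrier G)))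
    (basis (subchar_class (F \<times>\<times> G) u))"
  by (simp add: Phi_def)

lemma Phi_in: "x \<in> S_mor F G \<Longrightarrow> Phi F G x \<in> free_module (subchar_classes A (F \<times>\<times> G))"
  unfolding Phi_def
  by (rule linear_ext_in_free_module)
    (auto intro!: fscale.subspace_scale[OF subspace_free_module] basis_in_free_module
      simp: subchar_classes_def orbits_def)

lemma Phi_tw:
  assumes "F \<in> \<G>" "G \<in> \<G>" "f \<in> carrier F" "g \<in> carrier G" "x \<in> S_mor F G"
  shows "Phi F G (S_comp F G G (S_comp F F G (tw F f) x) (tw G g)) = Phi F G x"
  using assms(5)
proof (induction rule: free_module_induct)
  case (basis r u)
  interpret G: group G by (rule group_obj[OF assms(2)])
  show ?case
    using assms basis tw_basis_tw[OF assms(1-4) basis] group_prod[OF assms(1,2)]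
    by (simp add: bilinear_ext_simps Phi_basis card_conj_subchar subchar_class_conj del: bilinear_ext_basis)
qed (simp_all add: bilinear_ext_simps)

lemma Phi_tw_left:
  assumes "F \<in> \<G>" "G \<in> \<G>" "f \<in> carrier F" "x \<in> S_mor F G"
  shows "Phi F G (S_comp F F G (tw F f) x) = Phi F G x"
  using Phi_tw[OF assms(1-3) _ assms(4), of "\<one>\<^bsub>G\<^esub>"] group_obj[OF assms(2)]
    tw_one_right[OF assms(1,2) S_comp_in[OF assms(1,1,2) tw_in[OF assms(1,3)] assms(4)]]
  by (simp add: group.is_monoid)

lemma Phi_tw_right:
  assumes "F \<in> \<G>" "G \<in> \<G>" "g \<in> carrier G" "x \<in> S_mor F G"
  shows "Phi F G (S_comp F G G x (tw G g)) = Phi F G x"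
  using Phi_tw[OF assms(1,2) _ assms(3,4), of "\<one>\<^bsub>F\<^esub>"] group_obj[OF assms(1)]
    tw_one_left[OF assms(1,2,4)]
  by (simp add: group.is_monoid)

lemma Phi_avg:
  assumes "F \<in> \<G>" "G \<in> \<G>" "x \<in> S_mor F G"
  shows "Phi F G (avg F G x) = Phi F G x"
proof -
  have "Phi F G (S_comp F F G (idem F) y) = Phi F G y" if "y \<in> S_mor F G" for y
    using assms(1,2) that card_obj_pos[OF assms(1)]
    by (simp add: idem_eq bilinear_ext_simps module_hom.sum[OF bilinear_ext_left]
        fscale.sum_constant_scale Phi_tw_left)
  moreover have "Phi F G (S_comp F G G y (idem G)) = Phi F G y" if "y \<in> S_mor F G" for y
    using assms(1,2) that card_obj_pos[OF assms(2)]
    by (simp add: idem_eq bilinear_ext_simps module_hom.sum[OF bilinear_ext_right]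
        fscale.sum_constant_scale Phi_tw_right)
  ultimately show ?thesis
    using assms by (simp add: avg_def S_comp_in idem_in)
qed

text \<open>All \<open>\<sigma>(g)\<close> have the same image as \<open>\<sigma>(1)\<close>, the basis vector of the diagonal, for which
  \<open>|U| / |G| = 1\<close>.\<close>

lemma Phi_idem:
  assumes "G \<in> \<G>"
  shows "Phi G G (idem G) = basis (subchar_class (G \<times>\<times> G) (diagonal A G))"
proof -
  interpret G: group G by (rule group_obj[OF assms])
  have "Phi G G (tw G g) = Phi G G (tw G \<one>\<^bsub>G\<^esub>)" if "g \<in> carrier G" for g
    using Phi_tw_left[OF assms assms that tw_in[OF assms G.one_closed]] that assms
    by (simp add: tw_tw del: bilinear_ext_basis)
  moreover have "card (fst (diagonal A G)) = card (carrier G)"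
  proof -
    have "fst (diagonal A G) = (\<lambda>y. (y, y)) ` carrier G" by (auto simp: diagonal_def Let_def)
    then show ?thesis by (simp add: card_image inj_on_def)
  qed
  ultimately show ?thesis
    using card_obj_pos[OF assms]
    by (simp add: idem_eq fscale.sum_constant_scale flip: diagonal_eq[OF assms]) (simp add: Phi_basis)
qed

text \<open>The choice of a representative is immaterial, since \<open>s_bar\<close> and the order of the subgroup are
  constant on classes (\<open>Psi_class\<close>).\<close>

definition Psi :: "'g monoid \<Rightarrow> 'g monoid \<Rightarrow> (('g \<times> 'g, 'a) subchar set \<Rightarrow>\<^sub>0 'r)
    \<Rightarrow> (('g \<times> 'g, 'a) subchar \<Rightarrow>\<^sub>0 'r)"
  where "Psi F G = linear_ext (\<lambda>X. let u = (SOME u. u \<in> X) in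
    fscale (of_nat (card (carrier G)) * inv_of_nat (card (fst u))) (s_bar l A \<G> F G u))"

lemma Psi_linear [simp]: "Psi F G 0 = 0" "Psi F G (x + y) = Psi F G x + Psi F G y"
    "Psi F G (fscale r x) = fscale r (Psi F G x)"
  by (simp_all add: Psi_def linear_ext_zero linear_ext_add linear_ext_scale)

lemma class_representative:
  assumes "F \<in> \<G>" "G \<in> \<G>" "u \<in> Sub F G"
  obtains e where "e \<in> carrier (F \<times>\<times> G)"
    "(SOME v. v \<in> subchar_class (F \<times>\<times> G) u) = conj_subchar (F \<times>\<times> G) e u"
proof -
  have "(SOME v. v \<in> subchar_class (F \<times>\<times> G) u) \<in> subchar_class (F \<times>\<times> G) u"
    using subchar_class_refl[OF group_prod[OF assms(1,2)] assms(3)] by (rule someI)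
  then show ?thesis using that by (auto simp: orbit_def)
qed

lemma card_subchar_pos:
  assumes "F \<in> \<G>" "G \<in> \<G>" "u \<in> Sub F G"
  shows "card (fst u) > 0"
proof -
  obtain U \<mu> where u: "u = (U, \<mu>)" by (cases u)
  show ?thesis
    using finite_subchar[OF assms[unfolded u]] subchar_unit(1)[OF assms[unfolded u]]
    by (auto simp: u card_gt_0_iff)
qed

lemma Psi_class:
  assumes "F \<in> \<G>" "G \<in> \<G>" "u \<in> Sub F G"
  shows "Psi F G (basis (subchar_class (F \<times>\<times> G) u))
    = fscale (of_nat (card (carrier G)) * inv_of_nat (card (fst u))) (s_bar l A \<G> F G u)"
proof -
  obtain e where "e \<in> carrier (F \<times>\<times> G)"
    "(SOME v. v \<in> subchar_class (F \<times>\<times> G) u) = conj_subchar (F \<times>\<times> G) e u"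
    by (rule class_representative[OF assms])
  then show ?thesis
    using s_bar_conj[OF assms(1,2) _ assms(3)] card_conj_subchar[OF group_prod[OF assms(1,2)] _ assms(3)]
    by (simp add: Psi_def)
qed

lemma Phi_s_bar:
  assumes "F \<in> \<G>" "G \<in> \<G>" "u \<in> Sub F G"
  shows "Phi F G (s_bar l A \<G> F G u)
    = fscale (of_nat (card (fst u)) * inv_of_nat (card (carrier G))) (basis (subchar_class (F \<times>\<times> G) u))"
  using Phi_avg[OF assms(1,2) basis_in_free_module[OF assms(3)]] by (simp add: s_bar_eq Phi_basis)

lemma of_nat_cancel:
  assumes "m > 0" "n > 0"
  shows "of_nat m * inv_of_nat n * (of_nat n * inv_of_nat m) = (1 :: 'r)"
  using of_nat_inverse(1)[OF assms(1)] of_nat_inverse(2)[OF assms(2)]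
  by (metis mult.assoc mult.right_neutral)

lemma Psi_in:
  assumes "F \<in> \<G>" "G \<in> \<G>" "y \<in> free_module (subchar_classes A (F \<times>\<times> G))"
  shows "Psi F G y \<in> inv_mor F G"
  using assms(3)
proof (induction rule: free_module_induct)
  case (basis r X)
  then obtain u where "u \<in> Sub F G" "X = subchar_class (F \<times>\<times> G) u"
    by (auto simp: subchar_classes_def orbits_def)
  then show ?case
    using assms(1,2) by (auto simp: Psi_class s_bar_eq intro!: fscale.subspace_scale[OF subspace_inv_mor]
        avg_in basis_in_free_module)
qed (auto intro: fscale.subspace_0[OF subspace_inv_mor] fscale.subspace_add[OF subspace_inv_mor])

lemma Phi_Psi:
  assumes "F \<in> \<G>" "G \<in> \<G>" "y \<in> free_module (subchar_classes A (F \<times>\<times> G))"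
  shows "Phi F G (Psi F G y) = y"
  using assms(3)
proof (induction rule: free_module_induct)
  case (basis r X)
  then obtain u where u: "u \<in> Sub F G" "X = subchar_class (F \<times>\<times> G) u"
    by (auto simp: subchar_classes_def orbits_def)
  then show ?case
    using assms(1,2) of_nat_cancel[OF card_obj_pos[OF assms(2)] card_subchar_pos[OF assms(1,2) u(1)]]
    by (simp add: Psi_class Phi_s_bar mult.assoc)
qed simp_all

text \<open>The factors \<open>|U| / |G|\<close> and \<open>|G| / |U|\<close> cancel, so \<open>s\<^sub>u\<close> goes to \<open>s_bar\<close>; on invariants,
  symmetrisation is the identity.\<close>

lemma Psi_Phi_avg:
  assumes "F \<in> \<G>" "G \<in> \<G>" "x \<in> S_mor F G"
  shows "Psi F G (Phi F G x) = avg F G x"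
  using assms(3)
proof (induction rule: free_module_induct)
  case (basis r u)
  then show ?case
    using assms(1,2) of_nat_cancel[OF card_subchar_pos[OF assms(1,2) basis] card_obj_pos[OF assms(2)]]
    by (simp add: Psi_class Phi_basis s_bar_eq mult.assoc)
qed simp_all

end

section \<open>Double cosets and the multiplicativity of the isomorphism\<close>

lemma double_coset_mem:
  "x \<in> (P #>\<^bsub>G\<^esub> g) <#>\<^bsub>G\<^esub> Q \<longleftrightarrow> (\<exists>p\<in>P. \<exists>q\<in>Q. x = p \<otimes>\<^bsub>G\<^esub> g \<otimes>\<^bsub>G\<^esub> q)"
  by (auto simp: r_coset_def set_mult_def)

lemma (in group) double_coset_self:
  assumes "subgroup P G" "subgroup Q G" "g \<in> carrier G"
  shows "g \<in> (P #> g) <#> Q"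
  using assms subgroup.one_closed[OF assms(1)] subgroup.one_closed[OF assms(2)]
  unfolding double_coset_mem by (intro bexI[of _ \<one>]) simp_all

lemma (in group) double_coset_subset:
  assumes "subgroup P G" "subgroup Q G" "g \<in> carrier G"
  shows "(P #> g) <#> Q \<subseteq> carrier G"
  using assms subgroup.mem_carrier[OF assms(1)] subgroup.mem_carrier[OF assms(2)]
  by (auto simp: double_coset_mem)

lemma (in group) double_coset_eq:
  assumes "subgroup P G" "subgroup Q G" "g \<in> carrier G" "x \<in> (P #> g) <#> Q"
  shows "(P #> x) <#> Q = (P #> g) <#> Q"
proof -
  interpret P: subgroup P G by fact
  interpret Q: subgroup Q G by fact
  have sub: "(P #> x) <#> Q \<subseteq> (P #> g) <#> Q" if g: "g \<in> carrier G" and x: "x \<in> (P #> g) <#> Q" for g x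
  proof
    fix y assume "y \<in> (P #> x) <#> Q"
    then obtain p q where "p \<in> P" "q \<in> Q" "y = p \<otimes> x \<otimes> q"
      by (auto simp: double_coset_mem)
    moreover obtain p' q' where "p' \<in> P" "q' \<in> Q" "x = p' \<otimes> g \<otimes> q'"
      using x by (auto simp: double_coset_mem)
    ultimately show "y \<in> (P #> g) <#> Q"
      unfolding double_coset_mem using g
      by (intro bexI[of _ "p \<otimes> p'"] bexI[of _ "q' \<otimes> q"]) (simp_all add: m_assoc)
  qed
  obtain p q where pq: "p \<in> P" "q \<in> Q" "x = p \<otimes> g \<otimes> q" using assms(4) by (auto simp: double_coset_mem)
  have "inv p \<otimes> (p \<otimes> g \<otimes> q) \<otimes> inv q = g"
    using pq assms(3) by (simp add: m_assoc) (simp flip: m_assoc)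
  then have "g \<in> (P #> x) <#> Q"
    unfolding double_coset_mem using pq by (intro bexI[of _ "inv p"] bexI[of _ "inv q"]) simp_all
  moreover have "x \<in> carrier G" using pq assms(3) by simp
  ultimately show ?thesis using sub[OF assms(3,4)] sub[of x g] by blast
qed

lemma sum_double_cosets:
  fixes G :: "'g monoid"
  assumes "group G" "finite (carrier G)" "subgroup P G" "subgroup Q G"
  shows "(\<Sum>g\<in>carrier G. c g) = (\<Sum>D\<in>double_cosets G P Q. \<Sum>g\<in>D. c g)"
proof -
  interpret group G by fact
  have U: "carrier G = \<Union> (double_cosets G P Q)"
    using double_coset_self[OF assms(3,4)] double_coset_subset[OF assms(3,4)]
    unfolding double_cosets_def by blast
  have "sum c (\<Union> (double_cosets G P Q)) = (sum \<circ> sum) c (double_cosets G P Q)"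
  proof (rule sum.Union_disjoint)
    show "\<forall>D\<in>double_cosets G P Q. finite D"
      using U assms(2) by (metis Union_upper finite_subset)
    show "\<forall>D\<in>double_cosets G P Q. \<forall>E\<in>double_cosets G P Q. D \<noteq> E \<longrightarrow> D \<inter> E = {}"
      unfolding double_cosets_def using double_coset_eq[OF assms(3,4)] by blast
  qed
  then show ?thesis by (simp add: U[symmetric])
qed

context fibred_groups
begin

lemma subgroup_snd:
  assumes "F \<in> \<G>" "G \<in> \<G>" "(U, \<mu>) \<in> Sub F G"
  shows "subgroup (snd ` U) G"
proof (rule group.subgroupI[OF group_obj[OF assms(2)]])
  show "snd ` U \<subseteq> carrier G" using subchar_carrier[OF assms(3)] by auto
  show "snd ` U \<noteq> {}" using subchar_unit(1)[OF assms] by auto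
  show "inv\<^bsub>G\<^esub> a \<in> snd ` U" if "a \<in> snd ` U" for a
    using that subchar_inverse(1)[OF assms] by force
  show "a \<otimes>\<^bsub>G\<^esub> b \<in> snd ` U" if "a \<in> snd ` U" "b \<in> snd ` U" for a b
    using that subchar_mult(1)[OF assms(3)] by force
qed

lemma subgroup_fst:
  assumes "F \<in> \<G>" "G \<in> \<G>" "(U, \<mu>) \<in> Sub F G"
  shows "subgroup (fst ` U) F"
proof (rule group.subgroupI[OF group_obj[OF assms(1)]])
  show "fst ` U \<subseteq> carrier F" using subchar_carrier[OF assms(3)] by auto
  show "fst ` U \<noteq> {}" using subchar_unit(1)[OF assms] by auto
  show "inv\<^bsub>F\<^esub> a \<in> fst ` U" if "a \<in> fst ` U" for a
    using that subchar_inverse(1)[OF assms] by force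
  show "a \<otimes>\<^bsub>F\<^esub> b \<in> fst ` U" if "a \<in> fst ` U" "b \<in> fst ` U" for a b
    using that subchar_mult(1)[OF assms(3)] by force
qed

text \<open>The paths from \<open>f\<close> to \<open>h\<close> correspond to the middle elements, which form a coset of
  \<open>\<Gamma>\<^sub>\<inter>(U, V)\<close>.\<close>

lemma card_paths:
  assumes "F \<in> \<G>" "G \<in> \<G>" "H \<in> \<G>" "(U, \<mu>) \<in> Sub F G" "(V, \<nu>) \<in> Sub G H"
  shows "card {(f, k, h). (f, k) \<in> U \<and> (k, h) \<in> V} = card (U O V) * card (Gamma_cap F G H U V)"
proof -
  let ?T = "{(f, k, h). (f, k) \<in> U \<and> (k, h) \<in> V}" and ?e = "\<lambda>(f, k, h). (f, h)"
  have im: "?e ` ?T = U O V" by force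
  have "finite ?T"
    by (rule finite_subset[of _ "(\<lambda>((f, k), (k', h)). (f, k, h)) ` (U \<times> V)"])
      (use finite_subchar[OF assms(1,2,4)] finite_subchar[OF assms(2,3,5)] in \<open>force+\<close>)
  moreover have "card {t \<in> ?T. ?e t = b} = card (Gamma_cap F G H U V)" if bT: "b \<in> ?e ` ?T" for b
  proof -
    obtain f h where b: "b = (f, h)" "(f, h) \<in> U O V" using bT unfolding im by (cases b) auto
    have "{t \<in> ?T. ?e t = b} = (\<lambda>k. (f, k, h)) ` {k. (f, k) \<in> U \<and> (k, h) \<in> V}"
      by (auto simp: b)
    then show ?thesis using card_middle[OF assms b(2)] by (simp add: card_image inj_on_def)
  qed
  ultimately show ?thesis
    using card_eq_card_image_times[of ?T ?e] by (simp add: im)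
qed

text \<open>The map \<open>((f, p), (q, h)) \<mapsto> p\<inverse> g q\<close> sends \<open>U \<times> V\<close> onto the double coset.  Its fibre over \<open>g\<close>
  consists of the pairs with \<open>q = g\<inverse> p g\<close>, which are the paths \<open>f, p, h\<close> through \<open>U\<close> and the conjugate
  \<open>V'\<close> of \<open>V\<close>; every other fibre is a translate of this one.\<close>

lemma card_times_double_coset:
  assumes "F \<in> \<G>" "G \<in> \<G>" "H \<in> \<G>" "(U, \<mu>) \<in> Sub F G" "(V, \<nu>) \<in> Sub G H"
    and g: "g \<in> carrier G" and v: "conj_subchar (G \<times>\<times> H) (g, \<one>\<^bsub>H\<^esub>) (V, \<nu>) = (V', \<nu>')"
  shows "card U * card V = card ((snd ` U #>\<^bsub>G\<^esub> g) <#>\<^bsub>G\<^esub> fst ` V)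
    * (card (U O V') * card (Gamma_cap F G H U V'))"
proof -
  interpret F: group F by (rule group_obj[OF assms(1)])
  interpret G: group G by (rule group_obj[OF assms(2)])
  interpret H: group H by (rule group_obj[OF assms(3)])
  have v': "(V', \<nu>') \<in> Sub G H"
    using conj_subchar_in[OF group_prod[OF assms(2,3)] _ assms(5), of "(g, \<one>\<^bsub>H\<^esub>)"] g v by simp
  have V': "(k, h) \<in> V' \<longleftrightarrow> k \<in> carrier G \<and> h \<in> carrier H \<and> (inv\<^bsub>G\<^esub> g \<otimes>\<^bsub>G\<^esub> k \<otimes>\<^bsub>G\<^esub> g, h) \<in> V" for k h
    using conj_subchar_pair[OF assms(2,3) g H.one_closed assms(5)] v by (auto simp: Let_def)
  let ?T = "{(f, k, h). (f, k) \<in> U \<and> (k, h) \<in> V'}"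
  let ?m = "\<lambda>((f, p), (q, h)). inv\<^bsub>G\<^esub> p \<otimes>\<^bsub>G\<^esub> g \<otimes>\<^bsub>G\<^esub> q"
  let ?D = "(snd ` U #>\<^bsub>G\<^esub> g) <#>\<^bsub>G\<^esub> fst ` V"
  note cU = subchar_carrier[OF assms(4)] and cV = subchar_carrier[OF assms(5)]
  note iU = subchar_inverse(1)[OF assms(1,2,4)] and iV = subchar_inverse(1)[OF assms(2,3,5)]
  note mU = subchar_mult(1)[OF assms(4)] and mV = subchar_mult(1)[OF assms(5)]
  have im: "?m ` (U \<times> V) = ?D"
  proof (intro equalityI subsetI)
    fix x assume "x \<in> ?m ` (U \<times> V)"
    then obtain f p q h where x: "(f, p) \<in> U" "(q, h) \<in> V" "x = inv\<^bsub>G\<^esub> p \<otimes>\<^bsub>G\<^esub> g \<otimes>\<^bsub>G\<^esub> q" by auto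
    then show "x \<in> ?D"
      unfolding double_coset_mem using iU[OF x(1)]
      by (intro bexI[of _ "inv\<^bsub>G\<^esub> p"] bexI[of _ q]) force+
  next
    fix x assume "x \<in> ?D"
    then obtain f p q h where x: "(f, p) \<in> U" "(q, h) \<in> V" "x = p \<otimes>\<^bsub>G\<^esub> g \<otimes>\<^bsub>G\<^esub> q"
      by (auto simp: double_coset_mem)
    then show "x \<in> ?m ` (U \<times> V)"
      using iU[OF x(1)] cU[OF x(1)]
      by (intro image_eqI[of _ _ "((inv\<^bsub>F\<^esub> f, inv\<^bsub>G\<^esub> p), (q, h))"]) auto
  qed
  have fibre: "card {z \<in> U \<times> V. ?m z = x} = card ?T" if xm: "x \<in> ?m ` (U \<times> V)" for x
  proof -
    obtain a p b q where x: "(a, p) \<in> U" "(q, b) \<in> V" "x = inv\<^bsub>G\<^esub> p \<otimes>\<^bsub>G\<^esub> g \<otimes>\<^bsub>G\<^esub> q" using xm by auto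
    note c = cU[OF x(1)] cV[OF x(2)] g
    \<comment> \<open>Right multiplication by the inverses of \<open>(a, p)\<close> and \<open>(q, b)\<close> takes the fibre over
      \<open>x = p\<inverse> g q\<close> to the fibre over \<open>g\<close>, whose elements are recorded as paths.\<close>
    let ?to = "\<lambda>((f, p'), (q', h)). (f \<otimes>\<^bsub>F\<^esub> inv\<^bsub>F\<^esub> a, p' \<otimes>\<^bsub>G\<^esub> inv\<^bsub>G\<^esub> p, h \<otimes>\<^bsub>H\<^esub> inv\<^bsub>H\<^esub> b)"
    let ?from = "\<lambda>(f, k, h). ((f \<otimes>\<^bsub>F\<^esub> a, k \<otimes>\<^bsub>G\<^esub> p), (inv\<^bsub>G\<^esub> g \<otimes>\<^bsub>G\<^esub> k \<otimes>\<^bsub>G\<^esub> g \<otimes>\<^bsub>G\<^esub> q, h \<otimes>\<^bsub>H\<^esub> b))"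
    have key: "inv\<^bsub>G\<^esub> g \<otimes>\<^bsub>G\<^esub> (p' \<otimes>\<^bsub>G\<^esub> inv\<^bsub>G\<^esub> p) \<otimes>\<^bsub>G\<^esub> g = q' \<otimes>\<^bsub>G\<^esub> inv\<^bsub>G\<^esub> q"
      if "p' \<in> carrier G" "q' \<in> carrier G" "inv\<^bsub>G\<^esub> p' \<otimes>\<^bsub>G\<^esub> g \<otimes>\<^bsub>G\<^esub> q' = x" for p' q'
    proof -
      have "q' = inv\<^bsub>G\<^esub> g \<otimes>\<^bsub>G\<^esub> p' \<otimes>\<^bsub>G\<^esub> (inv\<^bsub>G\<^esub> p' \<otimes>\<^bsub>G\<^esub> g \<otimes>\<^bsub>G\<^esub> q')"
        using that(1,2) c by (simp add: G.m_assoc) (simp flip: G.m_assoc)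
      also have "\<dots> = inv\<^bsub>G\<^esub> g \<otimes>\<^bsub>G\<^esub> (p' \<otimes>\<^bsub>G\<^esub> inv\<^bsub>G\<^esub> p) \<otimes>\<^bsub>G\<^esub> g \<otimes>\<^bsub>G\<^esub> q"
        using that(1) c unfolding that(3) x(3) by (simp add: G.m_assoc)
      finally show ?thesis using that(1) c by (simp add: G.m_assoc)
    qed
    have "bij_betw ?to {z \<in> U \<times> V. ?m z = x} ?T"
    proof (rule bij_betw_byWitness[where f' = ?from])
      show "\<forall>z\<in>{z \<in> U \<times> V. ?m z = x}. ?from (?to z) = z"
      proof
        fix y assume "y \<in> {z \<in> U \<times> V. ?m z = x}"
        then obtain f p' q' h where y: "y = ((f, p'), (q', h))" and z: "(f, p') \<in> U" "(q', h) \<in> V"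
          and m: "inv\<^bsub>G\<^esub> p' \<otimes>\<^bsub>G\<^esub> g \<otimes>\<^bsub>G\<^esub> q' = x" by auto
        show "?from (?to y) = y" unfolding y
          using key[OF _ _ m] cU[OF z(1)] cV[OF z(2)] c
          by (simp add: F.m_assoc H.m_assoc) (simp add: G.m_assoc)
      qed
      show "\<forall>t\<in>?T. ?to (?from t) = t"
        using cU c subchar_carrier[OF v'] by (auto simp: F.m_assoc G.m_assoc H.m_assoc)
      show "?to ` {z \<in> U \<times> V. ?m z = x} \<subseteq> ?T"
      proof (rule image_subsetI)
        fix y assume "y \<in> {z \<in> U \<times> V. ?m z = x}"
        then obtain f p' q' h where y: "y = ((f, p'), (q', h))" and z: "(f, p') \<in> U" "(q', h) \<in> V"
          and m: "inv\<^bsub>G\<^esub> p' \<otimes>\<^bsub>G\<^esub> g \<otimes>\<^bsub>G\<^esub> q' = x" by auto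
        show "?to y \<in> ?T" unfolding y
          using mU[OF z(1) iU[OF x(1)]] mV[OF z(2) iV[OF x(2)]] key[OF _ _ m] cU[OF z(1)] cV[OF z(2)] c
          by (simp add: V')
      qed
      show "?from ` ?T \<subseteq> {z \<in> U \<times> V. ?m z = x}"
      proof (rule image_subsetI)
        fix y assume "y \<in> ?T"
        then obtain f k h where y: "y = (f, k, h)" and t: "(f, k) \<in> U" "(k, h) \<in> V'" by auto
        have "inv\<^bsub>G\<^esub> (k \<otimes>\<^bsub>G\<^esub> p) \<otimes>\<^bsub>G\<^esub> g \<otimes>\<^bsub>G\<^esub> (inv\<^bsub>G\<^esub> g \<otimes>\<^bsub>G\<^esub> k \<otimes>\<^bsub>G\<^esub> g \<otimes>\<^bsub>G\<^esub> q) = x"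
          using cU[OF t(1)] c unfolding x(3)
          by (simp add: G.inv_mult_group G.m_assoc) (simp flip: G.m_assoc)
        then show "?from y \<in> {z \<in> U \<times> V. ?m z = x}" unfolding y
          using mU[OF t(1) x(1)] mV[OF _ x(2), of _ h] t(2) by (simp add: V')
      qed
    qed
    then show ?thesis by (rule bij_betw_same_card)
  qed
  have "finite (U \<times> V)" using finite_subchar[OF assms(1,2,4)] finite_subchar[OF assms(2,3,5)] by simp
  from card_eq_card_image_times[OF this fibre] show ?thesis
    by (simp only: im card_cartesian_product card_paths[OF assms(1-4) v'])
qed

text \<open>The element \<open>(f, p)\<close> of \<open>U\<close> fixes \<open>(U, \<mu>)\<close> under conjugation, so conjugating by \<open>(1, p\<inverse>)\<close> has the
  same effect as conjugating by \<open>(1, p\<inverse>) (f, p) = (f, 1)\<close>.\<close>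

lemma tw_move_right:
  assumes "F \<in> \<G>" "G \<in> \<G>" "(U, \<mu>) \<in> Sub F G" "(f, p) \<in> U"
  shows "S_comp F G G (basis (U, \<mu>)) (tw G p) = S_comp F F G (tw F f) (basis (U, \<mu>))"
proof -
  interpret F: group F by (rule group_obj[OF assms(1)])
  interpret G: group G by (rule group_obj[OF assms(2)])
  note c = subchar_carrier[OF assms(3,4)]
  have "conj_subchar (F \<times>\<times> G) (\<one>\<^bsub>F\<^esub>, inv\<^bsub>G\<^esub> p) (U, \<mu>)
      = conj_subchar (F \<times>\<times> G) (\<one>\<^bsub>F\<^esub>, inv\<^bsub>G\<^esub> p) (conj_subchar (F \<times>\<times> G) (f, p) (U, \<mu>))"
    by (simp add: conj_subchar_self[OF comm_group_A group_prod[OF assms(1,2)] assms(3,4)])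
  also have "\<dots> = conj_subchar (F \<times>\<times> G) (f, \<one>\<^bsub>G\<^esub>) (U, \<mu>)"
    using c by (simp add: conj_subchar_mult[OF group_prod[OF assms(1,2)] _ _ assms(3)])
  finally show ?thesis
    using assms c by (simp add: S_mult_twisted_left S_mult_twisted_right)
qed

end

context rational_fibred_groups
begin

context
  fixes F G H :: "'g monoid" and U V :: "('g \<times> 'g) set" and \<mu> \<nu> :: "'g \<times> 'g \<Rightarrow> 'a"
  assumes obj: "F \<in> \<G>" "G \<in> \<G>" "H \<in> \<G>"
    and u: "(U, \<mu>) \<in> Sub F G" and v: "(V, \<nu>) \<in> Sub G H"
    and l_of_nat: "\<And>n. n > 0 \<Longrightarrow> l n = of_nat n"
begin

definition summand :: "'g \<Rightarrow> (('g \<times> 'g, 'a) subchar set \<Rightarrow>\<^sub>0 'r)"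
  where "summand g = Phi F H (S_comp F G H (basis (U, \<mu>)) (S_comp G G H (tw G g) (basis (V, \<nu>))))"

text \<open>For \<open>x = p g q\<close> the outer factors can be moved past the basis vectors:
  \<open>s\<^sub>u \<sigma>(p) \<sigma>(g) \<sigma>(q) s\<^sub>v = \<sigma>(f) s\<^sub>u \<sigma>(g) s\<^sub>v \<sigma>(h)\<close> with \<open>(f, p) \<in> U\<close> and \<open>(q, h) \<in> V\<close>, and \<open>\<Phi>\<close> ignores
  \<open>\<sigma>(f)\<close> and \<open>\<sigma>(h)\<close>.\<close>

lemma summand_double_coset:
  assumes "g \<in> carrier G" "x \<in> (snd ` U #>\<^bsub>G\<^esub> g) <#>\<^bsub>G\<^esub> fst ` V"
  shows "summand x = summand g"
proof -
  obtain f p q h where x: "(f, p) \<in> U" "(q, h) \<in> V" "x = p \<otimes>\<^bsub>G\<^esub> g \<otimes>\<^bsub>G\<^esub> q"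
    using assms(2) by (auto simp: double_coset_mem)
  note c = subchar_carrier[OF u x(1)] subchar_carrier[OF v x(2)] assms(1)
  interpret G: group G by (rule group_obj[OF obj(2)])
  let ?u = "basis (U, \<mu>) :: (('g \<times> 'g, 'a) subchar \<Rightarrow>\<^sub>0 'r)"
  let ?v = "basis (V, \<nu>) :: (('g \<times> 'g, 'a) subchar \<Rightarrow>\<^sub>0 'r)"
  have uv: "?u \<in> S_mor F G" "?v \<in> S_mor G H" using u v by (auto intro: basis_in_free_module)
  have t: "tw F f \<in> S_mor F F" "tw G p \<in> S_mor G G" "tw G q \<in> S_mor G G" "tw G g \<in> S_mor G G"
    "tw H h \<in> S_mor H H" using c obj by (auto intro: tw_in)
  have gv: "S_comp G G H (tw G g) ?v \<in> S_mor G H" using obj t uv by (intro S_comp_in)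
  have ugv: "S_comp F G H ?u (S_comp G G H (tw G g) ?v) \<in> S_mor F H" by (rule S_comp_in[OF obj uv(1) gv])
  have "tw G x = S_comp G G G (tw G p) (S_comp G G G (tw G g) (tw G q))"
    using c obj by (simp add: x(3) tw_tw G.m_assoc del: bilinear_ext_basis)
  then have "S_comp G G H (tw G x) ?v
      = S_comp G G H (tw G p) (S_comp G G H (tw G g) (S_comp G G H (tw G q) ?v))"
    using obj t uv by (simp add: S_comp_assoc S_comp_in del: bilinear_ext_basis)
  also have "S_comp G G H (tw G q) ?v = S_comp G H H ?v (tw H h)"
    by (rule tw_move_right[OF obj(2,3) v x(2), symmetric])
  also have "S_comp G G H (tw G g) \<dots> = S_comp G H H (S_comp G G H (tw G g) ?v) (tw H h)"
    by (rule S_comp_assoc[OF obj(2,2,3,3) t(4) uv(2) t(5), symmetric])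
  finally have "S_comp F G H ?u (S_comp G G H (tw G x) ?v)
      = S_comp F G H (S_comp F G G ?u (tw G p)) (S_comp G H H (S_comp G G H (tw G g) ?v) (tw H h))"
    using S_comp_assoc[OF obj(1,2,2,3) uv(1) t(2) S_comp_in[OF obj(2,3,3) gv t(5)]] by simp
  also have "S_comp F G G ?u (tw G p) = S_comp F F G (tw F f) ?u"
    by (rule tw_move_right[OF obj(1,2) u x(1)])
  also have "S_comp F G H \<dots> (S_comp G H H (S_comp G G H (tw G g) ?v) (tw H h))
      = S_comp F H H (S_comp F F H (tw F f) (S_comp F G H ?u (S_comp G G H (tw G g) ?v))) (tw H h)"
    using obj t uv gv ugv S_comp_in by (simp add: S_comp_assoc del: bilinear_ext_basis)
  finally show ?thesis
    using c obj ugv by (simp add: summand_def Phi_tw del: bilinear_ext_basis)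
qed

text \<open>After multiplication by the order of the double coset, the coefficient no longer depends on \<open>g\<close>.\<close>

lemma summand_eq:
  assumes "g \<in> carrier G" "v' = conj_subchar (G \<times>\<times> H) (g, \<one>\<^bsub>H\<^esub>) (V, \<nu>)"
  shows "fscale (of_nat (card ((snd ` U #>\<^bsub>G\<^esub> g) <#>\<^bsub>G\<^esub> fst ` V))) (summand g)
    = fscale (of_nat (card U * card V) * inv_of_nat (card (carrier H)))
        (if compat A F G H (U, \<mu>) v' then basis (subchar_class (F \<times>\<times> H) (star A (U, \<mu>) v')) else 0)"
proof -
  interpret H: group H by (rule group_obj[OF obj(3)])
  obtain V' \<nu>' where v': "v' = (V', \<nu>')" by (cases v')
  have v'S: "(V', \<nu>') \<in> Sub G H"
    using conj_subchar_in[OF group_prod[OF obj(2,3)] _ v, of "(g, \<one>\<^bsub>H\<^esub>)"] assms v' by simp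
  have eq: "conj_subchar (G \<times>\<times> H) (g, \<one>\<^bsub>H\<^esub>) (V, \<nu>) = (V', \<nu>')" using assms(2) v' by simp
  have "summand g = Phi F H (S_mult l A F G H (U, \<mu>) (V', \<nu>'))"
    unfolding summand_def by (simp add: S_mult_twisted_left[OF obj(2,3) assms(1) v] eq)
  also have "\<dots> = fscale (of_nat (card (Gamma_cap F G H U V')) * of_nat (card (U O V')) * inv_of_nat (card (carrier H)))
      (if compat A F G H (U, \<mu>) v' then basis (subchar_class (F \<times>\<times> H) (star A (U, \<mu>) v')) else 0)"
    by (simp add: S_mult_def Phi_basis v' l_of_nat[OF card_Gamma_cap_pos[OF obj u v'S]] mult.assoc)
  finally show ?thesis
    using card_times_double_coset[OF obj u v assms(1) eq] by (simp add: mult_ac)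
qed

lemma Phi_mult_representatives:
  "Phi F H (S_comp F G H (basis (U, \<mu>)) (S_comp G G H (idem G) (basis (V, \<nu>))))
    = fscale (of_nat (card U) * inv_of_nat (card (carrier G)) * (of_nat (card V) * inv_of_nat (card (carrier H))))
      (\<Sum>D\<in>double_cosets G (snd ` U) (fst ` V).
        let v' = conj_subchar (G \<times>\<times> H) (SOME g. g \<in> D, \<one>\<^bsub>H\<^esub>) (V, \<nu>)
        in if compat A F G H (U, \<mu>) v' then basis (subchar_class (F \<times>\<times> H) (star A (U, \<mu>) v')) else 0)"
    (is "?l = fscale ?c (\<Sum>D\<in>?DC. ?b D)")
proof -
  interpret G: group G by (rule group_obj[OF obj(2)])
  note sub = subgroup_snd[OF obj(1,2) u] subgroup_fst[OF obj(2,3) v]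
  have D: "(\<Sum>g\<in>D. summand g) = fscale (of_nat (card U * card V) * inv_of_nat (card (carrier H))) (?b D)"
    if DC: "D \<in> ?DC" for D
  proof -
    let ?g = "SOME g. g \<in> D"
    obtain g0 where g0: "g0 \<in> carrier G" "D = (snd ` U #>\<^bsub>G\<^esub> g0) <#>\<^bsub>G\<^esub> fst ` V"
      using DC by (auto simp: double_cosets_def)
    then have "?g \<in> D" using G.double_coset_self[OF sub g0(1)] by (metis someI)
    then have g: "?g \<in> carrier G" and Dg: "D = (snd ` U #>\<^bsub>G\<^esub> ?g) <#>\<^bsub>G\<^esub> fst ` V"
      using G.double_coset_subset[OF sub g0(1)] G.double_coset_eq[OF sub g0(1)] g0(2) by auto
    have "summand x = summand ?g" if "x \<in> D" for x
      using summand_double_coset[OF g] that Dg by simp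
    then have "(\<Sum>g\<in>D. summand g) = fscale (of_nat (card D)) (summand ?g)"
      by (simp add: fscale.sum_constant_scale)
    also have "\<dots> = fscale (of_nat (card U * card V) * inv_of_nat (card (carrier H))) (?b D)"
      using summand_eq[OF g refl] Dg by (simp add: Let_def)
    finally show ?thesis .
  qed
  have "?l = fscale (inv_of_nat (card (carrier G))) (\<Sum>g\<in>carrier G. summand g)"
    by (simp add: idem_eq bilinear_ext_simps module_hom.sum[OF bilinear_ext_left]
        module_hom.sum[OF bilinear_ext_right] summand_def)
  also have "(\<Sum>g\<in>carrier G. summand g)
      = fscale (of_nat (card U * card V) * inv_of_nat (card (carrier H))) (\<Sum>D\<in>?DC. ?b D)"
    using sum_double_cosets[OF G.is_group finite_obj[OF obj(2)] sub, of summand] D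
    by (simp add: fscale.scale_sum_right)
  finally show ?thesis by (simp add: mult_ac)
qed

end

text \<open>The product of fibred bisets is computed from chosen representatives of the classes, so the
  formula is first available for these.  It extends to \<open>u\<close> and \<open>v\<close> because neither side changes when
  they are replaced by conjugates: the factors \<open>\<sigma>(g)\<close> next to \<open>e\<^sub>G\<close> are absorbed by it, and \<open>\<Phi>\<close>
  ignores the outer ones.\<close>

lemma Phi_mult_basis:
  assumes l_of_nat: "\<And>n. n > 0 \<Longrightarrow> l n = of_nat n"
    and obj: "F \<in> \<G>" "G \<in> \<G>" "H \<in> \<G>" and u: "u \<in> Sub F G" and v: "v \<in> Sub G H"
  shows "Phi F H (S_comp F G H (basis u) (S_comp G G H (idem G) (basis v)))
    = bilinear_ext (B_mult A F G H) (Phi F G (basis u)) (Phi G H (basis v))"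
proof -
  interpret G: group G by (rule group_obj[OF obj(2)])
  interpret H: group H by (rule group_obj[OF obj(3)])
  let ?u = "basis u :: (('g \<times> 'g, 'a) subchar \<Rightarrow>\<^sub>0 'r)"
  let ?v = "basis v :: (('g \<times> 'g, 'a) subchar \<Rightarrow>\<^sub>0 'r)"
  obtain e where e: "e \<in> carrier (F \<times>\<times> G)"
    "(SOME w. w \<in> subchar_class (F \<times>\<times> G) u) = conj_subchar (F \<times>\<times> G) e u"
    by (rule class_representative[OF obj(1,2) u])
  obtain d where d: "d \<in> carrier (G \<times>\<times> H)"
    "(SOME w. w \<in> subchar_class (G \<times>\<times> H) v) = conj_subchar (G \<times>\<times> H) d v"
    by (rule class_representative[OF obj(2,3) v])
  obtain f g where fg: "e = (f, g)" "f \<in> carrier F" "g \<in> carrier G" using e(1) by auto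
  obtain k h where kh: "d = (k, h)" "k \<in> carrier G" "h \<in> carrier H" using d(1) by auto
  obtain U \<mu> where U: "conj_subchar (F \<times>\<times> G) e u = (U, \<mu>)" by (cases "conj_subchar (F \<times>\<times> G) e u")
  obtain V \<nu> where V: "conj_subchar (G \<times>\<times> H) d v = (V, \<nu>)" by (cases "conj_subchar (G \<times>\<times> H) d v")
  have US: "(U, \<mu>) \<in> Sub F G" and VS: "(V, \<nu>) \<in> Sub G H"
    using conj_subchar_in[OF group_prod[OF obj(1,2)] e(1) u]
      conj_subchar_in[OF group_prod[OF obj(2,3)] d(1) v] U V by simp_all
  have card: "card U = card (fst u)" "card V = card (fst v)"
    using card_conj_subchar[OF group_prod[OF obj(1,2)] e(1) u]
      card_conj_subchar[OF group_prod[OF obj(2,3)] d(1) v] U V by simp_all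
  have t: "tw F f \<in> S_mor F F" "tw G (inv\<^bsub>G\<^esub> g) \<in> S_mor G G" "tw G k \<in> S_mor G G"
      "tw H (inv\<^bsub>H\<^esub> h) \<in> S_mor H H" "?u \<in> S_mor F G" "?v \<in> S_mor G H" "idem G \<in> S_mor G G"
    using fg kh obj u v by (auto intro: tw_in basis_in_free_module idem_in)
  let ?ev = "S_comp G G H (idem G) ?v"
  let ?kv = "S_comp G G H (tw G k) ?v"
  have ev: "?ev \<in> S_mor G H" and kv: "?kv \<in> S_mor G H"
    and fu: "S_comp F F G (tw F f) ?u \<in> S_mor F G"
    by (rule S_comp_in[OF obj(2,2,3) t(7,6)], rule S_comp_in[OF obj(2,2,3) t(3,6)],
        rule S_comp_in[OF obj(1,1,2) t(1,5)])
  have eV: "S_comp G G H (idem G) (basis (V, \<nu>)) = S_comp G H H ?ev (tw H (inv\<^bsub>H\<^esub> h))"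
  proof -
    have "S_comp G G H (idem G) (basis (V, \<nu>)) = S_comp G G H (idem G) (S_comp G H H ?kv (tw H (inv\<^bsub>H\<^esub> h)))"
      using tw_basis_tw[OF obj(2,3) kh(2) H.inv_closed[OF kh(3)] v] V kh by simp
    also have "\<dots> = S_comp G H H (S_comp G G H (idem G) ?kv) (tw H (inv\<^bsub>H\<^esub> h))"
      by (rule S_comp_assoc[OF obj(2,2,3,3) t(7) kv t(4), symmetric])
    also have "S_comp G G H (idem G) ?kv = ?ev"
      using S_comp_assoc[OF obj(2,2,2,3) t(7,3,6)] idem_tw[OF obj(2) kh(2)] by simp
    finally show ?thesis .
  qed
  have ge: "S_comp G G H (tw G (inv\<^bsub>G\<^esub> g)) ?ev = ?ev"
    using S_comp_assoc[OF obj(2,2,2,3) t(2,7,6)] tw_idem[OF obj(2) G.inv_closed[OF fg(3)]] by simp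
  have evh: "S_comp G H H ?ev (tw H (inv\<^bsub>H\<^esub> h)) \<in> S_mor G H" by (rule S_comp_in[OF obj(2,3,3) ev t(4)])
  have "S_comp F G H (basis (U, \<mu>)) (S_comp G G H (idem G) (basis (V, \<nu>)))
      = S_comp F G H (S_comp F G G (S_comp F F G (tw F f) ?u) (tw G (inv\<^bsub>G\<^esub> g)))
          (S_comp G H H ?ev (tw H (inv\<^bsub>H\<^esub> h)))"
    using tw_basis_tw[OF obj(1,2) fg(2) G.inv_closed[OF fg(3)] u] U fg eV by simp
  also have "\<dots> = S_comp F G H (S_comp F F G (tw F f) ?u)
      (S_comp G H H (S_comp G G H (tw G (inv\<^bsub>G\<^esub> g)) ?ev) (tw H (inv\<^bsub>H\<^esub> h)))"
    by (simp only: S_comp_assoc[OF obj(1,2,2,3) fu t(2) evh] S_comp_assoc[OF obj(2,2,3,3) t(2) ev t(4)])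
  also have "\<dots> = S_comp F H H (S_comp F F H (tw F f) (S_comp F G H ?u ?ev)) (tw H (inv\<^bsub>H\<^esub> h))"
    by (simp only: ge S_comp_assoc[OF obj(1,2,3,3) fu ev t(4), symmetric] S_comp_assoc[OF obj(1,1,2,3) t(1,5) ev])
  finally have L: "Phi F H (S_comp F G H (basis (U, \<mu>)) (S_comp G G H (idem G) (basis (V, \<nu>))))
      = Phi F H (S_comp F G H ?u ?ev)"
    using Phi_tw[OF obj(1,3) fg(2) H.inv_closed[OF kh(3)] S_comp_in[OF obj t(5) ev]] by simp
  have B: "B_mult A F G H (subchar_class (F \<times>\<times> G) u) (subchar_class (G \<times>\<times> H) v)
    = (\<Sum>D\<in>double_cosets G (snd ` U) (fst ` V).
        let v' = conj_subchar (G \<times>\<times> H) (SOME g. g \<in> D, \<one>\<^bsub>H\<^esub>) (V, \<nu>)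
        in if compat A F G H (U, \<mu>) v' then basis (subchar_class (F \<times>\<times> H) (star A (U, \<mu>) v')) else 0)"
    by (simp add: B_mult_def e(2) d(2) U V Let_def)
  have "Phi F H (S_comp F G H ?u ?ev)
      = fscale (of_nat (card (fst u)) * inv_of_nat (card (carrier G))
          * (of_nat (card (fst v)) * inv_of_nat (card (carrier H))))
        (B_mult A F G H (subchar_class (F \<times>\<times> G) u) (subchar_class (G \<times>\<times> H) v))"
    unfolding B L[symmetric] card[symmetric] by (rule Phi_mult_representatives[OF obj US VS l_of_nat])
  then show ?thesis by (simp add: Phi_basis bilinear_ext_simps mult_ac)
qed

lemma Phi_mult:
  assumes l_of_nat: "\<And>n. n > 0 \<Longrightarrow> l n = of_nat n"
    and obj: "F \<in> \<G>" "G \<in> \<G>" "H \<in> \<G>" and x: "x \<in> S_mor F G" and y: "y \<in> S_mor G H"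
  shows "Phi F H (S_comp F G H x (S_comp G G H (idem G) y))
    = bilinear_ext (B_mult A F G H) (Phi F G x) (Phi G H y)"
  using x
proof (induction rule: free_module_induct)
  case (basis r u)
  from y show ?case
  proof (induction rule: free_module_induct)
    case (basis s v)
    then show ?case using Phi_mult_basis[OF l_of_nat obj \<open>u \<in> Sub F G\<close> basis]
      by (simp add: bilinear_ext_simps)
  qed (simp_all add: bilinear_ext_simps)
qed (simp_all add: bilinear_ext_simps)

theorem object_identical_isomorphism_Phi:
  assumes "\<And>n. n > 0 \<Longrightarrow> l n = of_nat n"
  shows "object_identical_isomorphism (inv_S_cat l A \<G>) (B_cat A \<G>) Phi"
proof (rule object_identical_isomorphism_transport[where \<Psi> = Psi])
  show "linear_category (inv_S_cat l A \<G>)" by (rule linear_category_inv_S_cat)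
  have C: "Obj (inv_S_cat l A \<G>) = \<G>" "Scl (inv_S_cat l A \<G>) = fscale"
    "Comp (inv_S_cat l A \<G>) = S_comp" "Ident (inv_S_cat l A \<G>) = idem"
    by (simp_all add: inv_S_cat_def S_cat_def)
  have S: "x \<in> S_mor F G" if "x \<in> inv_mor F G" for x F G using that by (simp add: inv_mor_def)
  show "Comp (B_cat A \<G>) F G H (Phi F G x) (Phi G H y) = Phi F H (Comp (inv_S_cat l A \<G>) F G H x y)"
    if "F \<in> Obj (inv_S_cat l A \<G>)" "G \<in> Obj (inv_S_cat l A \<G>)" "H \<in> Obj (inv_S_cat l A \<G>)"
      "x \<in> Mor (inv_S_cat l A \<G>) F G" "y \<in> Mor (inv_S_cat l A \<G>) G H" for F G H x y
  proof -
    have o: "F \<in> \<G>" "G \<in> \<G>" "H \<in> \<G>" and x: "x \<in> inv_mor F G" and y: "y \<in> inv_mor G H"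
      using that by (simp_all add: C Mor_inv_S_cat)
    have "S_comp G G H (idem G) y = y" using y o by (intro idem_left) (auto simp: inv_mor_def)
    then show ?thesis using Phi_mult[OF assms o S[OF x] S[OF y]] by (simp add: C B_cat_def)
  qed
  show "Psi F G (Phi F G x) = x"
    if "F \<in> Obj (inv_S_cat l A \<G>)" "G \<in> Obj (inv_S_cat l A \<G>)" "x \<in> Mor (inv_S_cat l A \<G>) F G" for F G x
    using that by (simp add: C Mor_inv_S_cat Psi_Phi_avg S avg_inv)
  show "Phi F G x \<in> Mor (B_cat A \<G>) F G"
    if "F \<in> Obj (inv_S_cat l A \<G>)" "G \<in> Obj (inv_S_cat l A \<G>)" "x \<in> Mor (inv_S_cat l A \<G>) F G" for F G x
    using that by (simp add: C Mor_inv_S_cat B_cat_def Phi_in S)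
  show "Psi F G y \<in> Mor (inv_S_cat l A \<G>) F G"
    if "F \<in> Obj (inv_S_cat l A \<G>)" "G \<in> Obj (inv_S_cat l A \<G>)" "y \<in> Mor (B_cat A \<G>) F G" for F G y
    using that by (simp add: C Mor_inv_S_cat B_cat_def Psi_in)
qed (simp_all add: inv_S_cat_def[of l A \<G>] S_cat_def[of l A \<G>] B_cat_def module_fscale Phi_idem Phi_Psi)

end

theorem corollary5p2:
  fixes \<G> :: "'g monoid set"
    and A :: "'a monoid"
    and l :: "nat \<Rightarrow> 'r::comm_ring_1"
  assumes "\<G> \<noteq> {}"
    and "\<And>G. G \<in> \<G> \<Longrightarrow> group G \<and> finite (carrier G)"
    and "\<And>n::nat. n > 0 \<Longrightarrow> (of_nat n :: 'r) dvd 1"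
    and "comm_group A"
    and "\<And>n. n > 0 \<Longrightarrow> l n dvd 1"
    and "l 1 = 1"
    and "\<And>m n. m > 0 \<Longrightarrow> n > 0 \<Longrightarrow> l (m * n) = l m * l n"
    and "\<And>n. n > 0 \<Longrightarrow> l n = of_nat n"
  shows "\<exists>\<Phi>. object_identical_isomorphism (inv_S_cat l A \<G>) (B_cat A \<G>) \<Phi> \<and>
    (\<forall>F\<in>\<G>. \<forall>G\<in>\<G>. \<forall>(U, \<mu>)\<in>subchars A (F \<times>\<times> G).
      \<Phi> F G (fscale (of_nat (card (carrier G))) (s_bar l A \<G> F G (U, \<mu>)))
        = fscale (of_nat (card U)) (basis (subchar_class (F \<times>\<times> G) (U, \<mu>))))"
proof -
  interpret rational_fibred_groups \<G> A l
    by (intro rational_fibred_groups.intro fibred_groups.intro rational_fibred_groups_axioms.intro)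
      (use assms in simp_all)
  have "Phi F G (fscale (of_nat (card (carrier G))) (s_bar l A \<G> F G (U, \<mu>)))
      = fscale (of_nat (card U)) (basis (subchar_class (F \<times>\<times> G) (U, \<mu>)))"
    if "F \<in> \<G>" "G \<in> \<G>" "(U, \<mu>) \<in> Sub F G" for F G U \<mu>
    using that card_obj_pos[OF that(2)] by (simp add: Phi_s_bar mult.left_commute)
  then show ?thesis
    using object_identical_isomorphism_Phi[OF assms(8)] by (intro exI[of _ Phi]) auto
qed

end
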